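(* Let $\xi$ be a simple stationary and ergodic point process on $\mathbb{R}^n$ having all finite moments. Then the persistence diagram expectation measure $\mathfrak{p}$ corresponding to $\xi$ exists.
   Context: $(\Omega,\mathcal{E},\mathbb{P})$ is a probability space, $\mathcal{B}^n_b$ the bounded Borel subsets of $\mathbb{R}^n$, $\lambda_n$ Lebesgue measure. A point process on $\mathbb{R}^n$ is a random integer-valued boundedly finite measure $\xi$; simple: a.s. all atoms are distinct; all finite moments: $\mathbb{E}[\xi(A)^k]<\infty$ for all $k\ge1$, $A\in\mathcal{B}^n_b$; stationary: distribution invariant under all translations; ergodic: stationary and $\mathbb{P}(\xi\in\mathcal{A})\in\{0,1\}$ for every translation-invariant Borel set $\mathcal{A}$ of boundedly finite measures. Standing assumption: $\mathbb{E}[\xi(A)]>0$ whenever $\lambda_n(A)>0$, $A\in\mathcal{B}^n_b$. $X_{\xi_\omega}(A)$ is the (a.s. finite) set of atoms of $\xi_\omega$ in $A$. $\Delta=\{(b,d)\in\mathbb{R}^2:b<d\}$. For a finite $X\subset\mathbb{R}^n$, $\mathrm{Dgm}_\ell(X)$ is the $\ell$-th persistence diagram (finite multiset of birth-death pairs $(b,d)\in\Delta$, zero-persistence pairs ignored; homology over a fixed field) of the filtration of Čech complexes $\check C_r(X)=\{\sigma\subseteq X:\bigcap_{x\in\sigma}B_r(x)\ne\emptyset\}$, $r\ge0$. For $A\in\mathcal{B}^n_b$, the persistence diagram measure is $\rho_\omega(A)=\sum_{x\in D}\delta_x$ with $D=\bigcup_{\ell=0}^{n-1}\mathrm{Dgm}_\ell(X_{\xi_\omega}(A))$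 (multiset union). The persistence diagram expectation measure is the map $\mathfrak{p}:A\mapsto\mathfrak{p}(A):=\mathbb{E}[\rho_\omega(A)]$ (first moment measure) from $\mathcal{B}^n_b$ to the Radon measures on $\Delta$; it is said to exist if these first moment measures exist as Radon measures (finite on relatively compact Borel sets). *)

theory Defs
  imports "HOL-Probability.Probability" "HOL-Library.Function_Algebras"
begin

section \<open>Simplicial homology over a field\<close>

text \<open>
  Oriented chains. An \<open>l\<close>-chain of a finite simplicial complex \<open>K\<close> (a set of nonempty finite
  sets) is given by its coefficients: \<open>c [v\<^sub>0, \<dots>, v\<^sub>l]\<close> is the coefficient of the oriented simplex
  \<open>[v\<^sub>0, \<dots>, v\<^sub>l]\<close>, so exchanging two neighbouring vertices changes the sign. No vertex order
  has to be chosen.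
\<close>

definition chains :: "nat \<Rightarrow> 'v set set \<Rightarrow> ('v list \<Rightarrow> 'k::field) set" where
  "chains l K = {c.
     (\<forall>xs. c xs \<noteq> 0 \<longrightarrow> length xs = Suc l \<and> distinct xs \<and> set xs \<in> K) \<and>
     (\<forall>us x y vs. c (us @ x # y # vs) = - c (us @ y # x # vs))}"

text \<open>
  The oriented simplex \<open>ys\<close> occurs in the boundary of \<open>v # ys\<close> with sign \<open>+\<close>, which gives the
  coefficient below. The value at the empty list is \<open>0\<close> because there are no chains of
  degree \<open>-1\<close> (homology is unreduced).
\<close>

definition boundary :: "('v list \<Rightarrow> 'k::field) \<Rightarrow> 'v list \<Rightarrow> 'k" where
  "boundary c ys = (if ys = [] then 0 else \<Sum>v | c (v # ys) \<noteq> 0. c (v # ys))"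

definition cycles :: "nat \<Rightarrow> 'v set set \<Rightarrow> ('v list \<Rightarrow> 'k::field) set" where
  "cycles l K = {c \<in> chains l K. boundary c = 0}"

definition boundaries :: "nat \<Rightarrow> 'v set set \<Rightarrow> ('v list \<Rightarrow> 'k::field) set" where
  "boundaries l K = boundary ` chains (Suc l) K"

definition chain_scale :: "'k::field \<Rightarrow> ('v list \<Rightarrow> 'k) \<Rightarrow> 'v list \<Rightarrow> 'k" where
  "chain_scale a c = (\<lambda>xs. a * c xs)"

lemma vector_space_chain_scale: "vector_space chain_scale"
  by unfold_locales (auto simp: chain_scale_def fun_eq_iff algebra_simps)

abbreviation chain_dim :: "('v list \<Rightarrow> 'k::field) set \<Rightarrow> nat" where
  "chain_dim \<equiv> vector_space.dim chain_scale"

text \<open>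
  For complexes \<open>K \<subseteq> L\<close> the persistent homology group, i.e. the image of
  \<open>H\<^sub>l(K) \<rightarrow> H\<^sub>l(L)\<close>, is \<open>Z\<^sub>l(K) / (Z\<^sub>l(K) \<inter> B\<^sub>l(L))\<close>; its dimension is the persistent Betti number.
\<close>

definition persistent_betti :: "'k::field itself \<Rightarrow> nat \<Rightarrow> 'v set set \<Rightarrow> 'v set set \<Rightarrow> nat" where
  "persistent_betti _ l K L =
     chain_dim (cycles l K :: ('v list \<Rightarrow> 'k) set)
     - chain_dim (cycles l K \<inter> boundaries l L :: ('v list \<Rightarrow> 'k) set)"


section \<open>Persistence diagrams of Cech filtrations\<close>

text \<open>Closed balls; the complex is empty for negative radius, i.e. before the filtration starts.\<close>

definition cech :: "'a::metric_space set \<Rightarrow> real \<Rightarrow> 'a set set" where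
  "cech X r = {\<sigma>. \<sigma> \<noteq> {} \<and> \<sigma> \<subseteq> X \<and> (\<Inter>x\<in>\<sigma>. cball x r) \<noteq> {}}"

definition cech_betti :: "'k::field itself \<Rightarrow> nat \<Rightarrow> 'a::metric_space set \<Rightarrow> real \<Rightarrow> real \<Rightarrow> nat" where
  "cech_betti F l X s t = persistent_betti F l (cech X s) (cech X t)"

definition Delta :: "(real \<times> real) set" where
  "Delta = {(b, d). b < d}"

text \<open>
  Multiplicity of \<open>(b, d)\<close> in the diagram (Edelsbrunner--Letscher--Zomorodian,
  Cohen-Steiner--Edelsbrunner--Harer): the number of independent classes that are alive just after
  \<open>b\<close> but not just before \<open>b\<close>, and alive just before \<open>d\<close> but not just after \<open>d\<close>. For finite \<open>X\<close> the complex changes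
  at finitely many radii only, so the expression does not depend on small \<open>\<epsilon> > 0\<close>.
\<close>

definition pd_mult :: "'k::field itself \<Rightarrow> nat \<Rightarrow> 'a::metric_space set \<Rightarrow> real \<times> real \<Rightarrow> nat" where
  "pd_mult F l X = (\<lambda>(b, d). THE m. \<forall>\<^sub>F \<epsilon> in at_right 0.
     int m = (int (cech_betti F l X (b + \<epsilon>) (d - \<epsilon>)) - int (cech_betti F l X (b + \<epsilon>) (d + \<epsilon>)))
           - (int (cech_betti F l X (b - \<epsilon>) (d - \<epsilon>)) - int (cech_betti F l X (b - \<epsilon>) (d + \<epsilon>))))"

text \<open>
  For finite \<open>X\<close>. Points of \<open>Delta\<close> have finite death, so the essential class in
  degree \<open>0\<close> does not contribute.
\<close>

definition Dgm :: "'k::field itself \<Rightarrow> nat \<Rightarrow> 'a::metric_space set \<Rightarrow> (real \<times> real) multiset" where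
  "Dgm F l X = Abs_multiset (\<lambda>p. if p \<in> Delta then pd_mult F l X p else 0)"


section \<open>Point processes\<close>

definition bounded_borel :: "'a::euclidean_space set set" where
  "bounded_borel = {A \<in> sets borel. bounded A}"

definition boundedly_finite :: "'a::euclidean_space measure set" where
  "boundedly_finite = {\<mu>. sets \<mu> = sets borel \<and> (\<forall>A\<in>bounded_borel. emeasure \<mu> A < \<infinity>)}"

text \<open>
  The \<open>w\<^sup>#\<close>-topology (here the vague topology): the coarsest one making
  \<open>\<mu> \<mapsto> \<integral> f d\<mu>\<close> continuous for all continuous \<open>f\<close> vanishing outside a bounded set.
\<close>

definition wsharp_topology :: "'a::euclidean_space measure topology" where
  "wsharp_topology = topology_generated_by
     {{\<mu> \<in> boundedly_finite. integral\<^sup>L \<mu> f \<in> U} | (f :: 'a \<Rightarrow> real) U.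
        continuous_on UNIV f \<and> bounded {x. f x \<noteq> 0} \<and> open U}"

definition bf_borel :: "'a::euclidean_space measure measure" where
  "bf_borel = sigma boundedly_finite {U. openin wsharp_topology U}"

definition point_process :: "'w measure \<Rightarrow> ('w \<Rightarrow> 'a::euclidean_space measure) \<Rightarrow> bool" where
  "point_process P \<xi> \<longleftrightarrow> \<xi> \<in> measurable P bf_borel \<and>
     (\<forall>\<omega>\<in>space P. \<forall>A\<in>bounded_borel. emeasure (\<xi> \<omega>) A \<in> \<nat>)"

definition simple_process :: "'w measure \<Rightarrow> ('w \<Rightarrow> 'a::euclidean_space measure) \<Rightarrow> bool" where
  "simple_process P \<xi> \<longleftrightarrow> (AE \<omega> in P. \<forall>x. emeasure (\<xi> \<omega>) {x} \<le> 1)"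

definition all_finite_moments :: "'w measure \<Rightarrow> ('w \<Rightarrow> 'a::euclidean_space measure) \<Rightarrow> bool" where
  "all_finite_moments P \<xi> \<longleftrightarrow>
     (\<forall>k\<ge>1. \<forall>A\<in>bounded_borel. (\<integral>\<^sup>+ \<omega>. emeasure (\<xi> \<omega>) A ^ k \<partial>P) < \<infinity>)"

definition shift :: "'a::euclidean_space \<Rightarrow> 'a measure \<Rightarrow> 'a measure" where
  "shift x \<mu> = distr \<mu> borel (\<lambda>y. y + x)"

definition stationary :: "'w measure \<Rightarrow> ('w \<Rightarrow> 'a::euclidean_space measure) \<Rightarrow> bool" where
  "stationary P \<xi> \<longleftrightarrow> (\<forall>x. distr P bf_borel (\<lambda>\<omega>. shift x (\<xi> \<omega>)) = distr P bf_borel \<xi>)"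

definition ergodic :: "'w measure \<Rightarrow> ('w \<Rightarrow> 'a::euclidean_space measure) \<Rightarrow> bool" where
  "ergodic P \<xi> \<longleftrightarrow> stationary P \<xi> \<and>
     (\<forall>\<A>\<in>sets bf_borel. (\<forall>x. shift x ` \<A> = \<A>) \<longrightarrow>
        measure P {\<omega> \<in> space P. \<xi> \<omega> \<in> \<A>} \<in> {0, 1})"

definition atoms :: "'a::euclidean_space measure \<Rightarrow> 'a set \<Rightarrow> 'a set" where
  "atoms \<mu> A = {x \<in> A. emeasure \<mu> {x} > 0}"


section \<open>The persistence diagram expectation measure\<close>

definition borel_Delta :: "(real \<times> real) measure" where
  "borel_Delta = restrict_space borel Delta"

definition dirac_sum :: "(real \<times> real) multiset \<Rightarrow> (real \<times> real) measure" where
  "dirac_sum D = measure_of Delta (sets borel_Delta) (\<lambda>B. \<Sum>x\<in>#D. indicator B x)"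

definition pd_measure :: "'k::field itself \<Rightarrow> (real ^ 'n) measure \<Rightarrow> (real ^ 'n) set \<Rightarrow> (real \<times> real) measure" where
  "pd_measure F \<mu> A = dirac_sum (\<Sum>l<CARD('n). Dgm F l (atoms \<mu> A))"

definition radon_on_Delta :: "(real \<times> real) measure \<Rightarrow> bool" where
  "radon_on_Delta m \<longleftrightarrow> sets m = sets borel_Delta \<and>
     (\<forall>B\<in>sets m. (\<exists>K. compact K \<and> K \<subseteq> Delta \<and> B \<subseteq> K) \<longrightarrow> emeasure m B < \<infinity>)"

text \<open>
  Measurability is demanded explicitly since the nonnegative integral is also defined for
  non-measurable functions.
\<close>

definition first_moment_measure ::
    "'w measure \<Rightarrow> ('w \<Rightarrow> (real \<times> real) measure) \<Rightarrow> (real \<times> real) measure \<Rightarrow> bool" where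
  "first_moment_measure P \<rho> m \<longleftrightarrow> radon_on_Delta m \<and>
     (\<forall>B\<in>sets borel_Delta. (\<lambda>\<omega>. emeasure (\<rho> \<omega>) B) \<in> borel_measurable P \<and>
        emeasure m B = (\<integral>\<^sup>+ \<omega>. emeasure (\<rho> \<omega>) B \<partial>P))"

definition pd_expectation_measure ::
    "'k::field itself \<Rightarrow> 'w measure \<Rightarrow> ('w \<Rightarrow> (real ^ 'n) measure)
      \<Rightarrow> ((real ^ 'n) set \<Rightarrow> (real \<times> real) measure) \<Rightarrow> bool" where
  "pd_expectation_measure F P \<xi> \<pp> \<longleftrightarrow>
     (\<forall>A\<in>bounded_borel. first_moment_measure P (\<lambda>\<omega>. pd_measure F (\<xi> \<omega>) A) (\<pp> A))"

end

theory Submission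
  imports Defs
begin

text \<open>
  Two things have to be shown for a bounded Borel set \<open>A\<close> and a Borel set \<open>B \<subseteq> \<Delta>\<close>: that the number of
  diagram points in \<open>B\<close> is a measurable function of the sample, and that its expectation is finite.
  Monotone convergence then makes the expectation a measure in \<open>B\<close>.

  For finiteness, note that homology in degree \<open>l\<close> only sees simplices with \<open>l + 1\<close> or \<open>l + 2\<close> vertices
  (\<open>persistent_betti_restrict\<close>). Hence the coordinates of a diagram point are among the radii at which
  such simplices enter the Cech filtration, and every multiplicity is determined by an alternating sum
  of Betti numbers, each at most the dimension of a chain space. The number of these radii and these dimensions
  are polynomial in the number \<open>N\<close> of points, so the size of the
  diagram is at most a constant times a power of \<open>N\<close> (\<open>size_Dgm_le\<close>). Since \<open>N\<close> is at most the mass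
  of \<open>A\<close>, the moment assumption bounds the expectation.

  Measurability starts from locating the points. As the process is integer-valued, a bounded Borel set has positive mass iff it contains an
  atom (\<open>emeasure_pos_iff_atom\<close>): a point that is not an atom has a null neighbourhood, and countably many of
  these suffice. Therefore the atoms in \<open>A\<close> can be located by testing the masses of sets from a
  countable basis, and the probability space is covered by countably many events on each of which
  the atoms are enumerated by finitely many measurable maps (\<open>measurable_enumeration_of_atoms\<close>). Given
  such an enumeration, each simplex of indices has a measurable entry radius, and the multiplicities depend
  only on the relative order of these finitely many radii, because a bijection of the vertices preserves Betti
  numbers (\<open>pd_mult_order_type\<close>). On each of the finitely many events that fix this order, the
  number of diagram points in \<open>B\<close> is thus a fixed linear combination of indicators of measurable events
  (\<open>sum_Dgm_measurable\<close>).
\<close>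

section \<open>Persistent Betti numbers\<close>

lemma chains_support:
  "c \<in> chains l K \<Longrightarrow> c xs \<noteq> 0 \<Longrightarrow> length xs = Suc l \<and> distinct xs \<and> set xs \<in> K"
  unfolding chains_def by blast

lemma chains_swap: "c \<in> chains l K \<Longrightarrow> c (us @ x # y # vs) = - c (us @ y # x # vs)"
  unfolding chains_def by blast

lemma chainsI:
  assumes "\<And>xs. c xs \<noteq> 0 \<Longrightarrow> length xs = Suc l \<and> distinct xs \<and> set xs \<in> K"
    and "\<And>us x y vs. c (us @ x # y # vs) = - c (us @ y # x # vs)"
  shows "c \<in> chains l K"
  using assms unfolding chains_def by blast

lemma chains_restrict:
  assumes "{s \<in> K. card s = Suc l} \<subseteq> L" "L \<subseteq> K"
  shows "chains l L = chains l K"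
proof (intro equalityI subsetI)
  fix c assume c: "c \<in> chains l L"
  show "c \<in> chains l K"
    by (rule chainsI) (use chains_support[OF c] assms(2) in blast, rule chains_swap[OF c])
next
  fix c assume c: "c \<in> chains l K"
  show "c \<in> chains l L"
  proof (rule chainsI)
    fix xs assume "c xs \<noteq> 0"
    with c have "length xs = Suc l \<and> distinct xs \<and> set xs \<in> K" by (rule chains_support)
    with assms(1) show "length xs = Suc l \<and> distinct xs \<and> set xs \<in> L"
      using distinct_card by fastforce
  qed (rule chains_swap[OF c])
qed

text \<open>
  Cycles of degree \<open>l\<close> live on \<open>l\<close>-simplices and boundaries come from \<open>(l + 1)\<close>-simplices.
\<close>

lemma persistent_betti_restrict:
  assumes "{s \<in> K. card s = l + 1 \<or> card s = l + 2} \<subseteq> K'" "K' \<subseteq> K"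
    and "{s \<in> L. card s = l + 1 \<or> card s = l + 2} \<subseteq> L'" "L' \<subseteq> L"
  shows "persistent_betti F l K' L' = persistent_betti F l K L"
proof -
  have *: "chains l K' = chains l K" "chains (Suc l) L' = chains (Suc l) L"
    by (rule chains_restrict; use assms in auto)+
  show ?thesis
    unfolding persistent_betti_def cycles_def boundaries_def * ..
qed

text \<open>
  The indicator functions of the elements of \<open>S\<close> span all functions supported in \<open>S\<close>.
\<close>

lemma chain_dim_le:
  fixes V :: "('v list \<Rightarrow> 'k::field) set"
  assumes "finite S" and supp: "\<And>c xs. c \<in> V \<Longrightarrow> c xs \<noteq> 0 \<Longrightarrow> xs \<in> S"
  shows "chain_dim V \<le> card S"
proof -
  interpret vector_space "chain_scale :: 'k \<Rightarrow> ('v list \<Rightarrow> 'k) \<Rightarrow> _"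
    by (rule vector_space_chain_scale)
  define e :: "'v list \<Rightarrow> 'v list \<Rightarrow> 'k" where "e = (\<lambda>xs ys. if ys = xs then 1 else 0)"
  have "V \<subseteq> span (e ` S)"
  proof
    fix c assume "c \<in> V"
    have "c = (\<Sum>xs\<in>S. chain_scale (c xs) (e xs))"
    proof
      fix ys
      have "(\<Sum>xs\<in>S. chain_scale (c xs) (e xs)) ys = (\<Sum>xs\<in>S. if xs = ys then c xs else 0)"
        using \<open>finite S\<close> by (induction S) (auto simp: chain_scale_def e_def)
      also have "\<dots> = c ys"
        using supp[OF \<open>c \<in> V\<close>, of ys] \<open>finite S\<close> by (auto simp: sum.delta')
      finally show "c ys = (\<Sum>xs\<in>S. chain_scale (c xs) (e xs)) ys" by simp
    qed
    also have "\<dots> \<in> span (e ` S)"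
      by (intro span_sum span_scale span_base) auto
    finally show "c \<in> span (e ` S)" .
  qed
  then have "dim V \<le> card (e ` S)"
    using \<open>finite S\<close> by (intro dim_le_card) auto
  also have "\<dots> \<le> card S" by (rule card_image_le[OF \<open>finite S\<close>])
  finally show ?thesis .
qed

lemma persistent_betti_le:
  assumes "finite X" "\<And>s. s \<in> K \<Longrightarrow> s \<subseteq> X"
  shows "persistent_betti F l K L \<le> card X ^ (l + 1)"
proof -
  have "chain_dim (cycles l K :: ('a list \<Rightarrow> 'k::field) set) \<le> card {xs. set xs \<subseteq> X \<and> length xs = l + 1}"
    using assms by (intro chain_dim_le finite_lists_length_eq) (auto simp: cycles_def chains_def)
  also have "\<dots> = card X ^ (l + 1)" by (rule card_lists_length_eq[OF assms(1)])
  finally have "chain_dim (cycles l K :: ('a list \<Rightarrow> 'k::field) set) \<le> card X ^ (l + 1)" .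
  then show ?thesis unfolding persistent_betti_def by (rule le_trans[OF diff_le_self])
qed

lemma chain_dim_linear_inj_image:
  fixes T :: "('v list \<Rightarrow> 'k::field) \<Rightarrow> 'w list \<Rightarrow> 'k"
  assumes add: "\<And>c d. T (c + d) = T c + T d"
    and scale: "\<And>a c. T (chain_scale a c) = chain_scale a (T c)"
    and inj: "inj T"
  shows "chain_dim (T ` V) = chain_dim V"
proof -
  interpret vector_space_pair "chain_scale :: 'k \<Rightarrow> ('v list \<Rightarrow> 'k) \<Rightarrow> _"
      "chain_scale :: 'k \<Rightarrow> ('w list \<Rightarrow> 'k) \<Rightarrow> _"
    by (intro vector_space_pair.intro vector_space_chain_scale)
  have lin: "Vector_Spaces.linear chain_scale chain_scale T"
    by unfold_locales (simp_all add: add scale)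
  obtain B where B: "vs1.independent B" "vs1.span B = vs1.span V"
    by (metis vs1.maximal_independent_subset vs1.span_mono vs1.span_span subset_antisym)
  have "vs2.independent (T ` B)"
    by (rule linear_independent_injective_image[OF lin B(1)]) (rule inj_on_subset[OF inj], auto)
  moreover have "vs2.span (T ` B) = vs2.span (T ` V)"
    using B(2) by (simp add: linear_span_image[OF lin])
  ultimately have "vs2.dim (T ` V) = card (T ` B)"
    by (intro vs2.dim_eq_card) auto
  also have "\<dots> = card B" by (rule card_image) (rule inj_on_subset[OF inj], auto)
  also have "\<dots> = vs1.dim V" using B by (intro vs1.dim_eq_card[symmetric]) auto
  finally show ?thesis .
qed

text \<open>
  The chain map induced by a bijection \<open>f\<close> of the vertices.
\<close>

definition relabel :: "('v \<Rightarrow> 'w) \<Rightarrow> ('v list \<Rightarrow> 'k::field) \<Rightarrow> 'w list \<Rightarrow> 'k" where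
  "relabel f c = (\<lambda>xs. c (map (inv f) xs))"

lemma relabel_inv:
  assumes "bij f"
  shows "relabel (inv f) (relabel f c) = c" "relabel f (relabel (inv f) d) = d"
proof -
  have "f \<circ> inv f = id" "inv f \<circ> f = id"
    using assms by (metis bij_is_surj surj_iff, metis bij_is_inj inv_o_cancel)
  then show "relabel (inv f) (relabel f c) = c" "relabel f (relabel (inv f) d) = d"
    using assms by (auto simp: relabel_def inv_inv_eq)
qed

lemma relabel_chains_subset:
  assumes f: "bij f"
  shows "relabel f ` chains l K \<subseteq> chains l ((`) f ` K)"
proof -
  have "c (map (inv f) xs) \<noteq> 0 \<Longrightarrow> length xs = Suc l \<and> distinct xs \<and> set xs \<in> (`) f ` K"
    if c: "c \<in> chains l K" for c :: "'a list \<Rightarrow> 'k::field" and xs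
  proof -
    assume "c (map (inv f) xs) \<noteq> 0"
    from chains_support[OF c this]
    have *: "length xs = Suc l" "distinct (map (inv f) xs)" "inv f ` set xs \<in> K"
      by auto
    have "f ` inv f ` set xs = set xs"
      using f by (simp add: bij_is_surj image_f_inv_f)
    with * show ?thesis by (metis distinct_map image_eqI)
  qed
  moreover have "c (map (inv f) (us @ x # y # vs)) = - c (map (inv f) (us @ y # x # vs))"
    if "c \<in> chains l K" for c :: "'a list \<Rightarrow> 'k::field" and us x y vs
    using chains_swap[OF that, of "map (inv f) us"] unfolding map_append list.map .
  ultimately show ?thesis unfolding relabel_def by (intro image_subsetI chainsI)
qed

lemma relabel_chains:
  assumes f: "bij f"
  shows "relabel f ` chains l K = chains l ((`) f ` K)"
proof (intro equalityI relabel_chains_subset[OF f] subsetI)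
  fix c assume c: "c \<in> chains l ((`) f ` K)"
  have "relabel (inv f) c \<in> chains l ((`) (inv f) ` (`) f ` K)"
    using relabel_chains_subset[OF bij_imp_bij_inv[OF f]] c by blast
  also have "(`) (inv f) ` (`) f ` K = K"
    using f by (auto simp: image_image image_inv_f_f bij_is_inj)
  finally show "c \<in> relabel f ` chains l K"
    using relabel_inv(2)[OF f, of c] by (metis image_eqI)
qed

lemma relabel_boundary:
  assumes f: "bij f"
  shows "boundary (relabel f c) = relabel f (boundary c)"
proof
  fix ys
  have "(\<Sum>v | c (inv f v # map (inv f) ys) \<noteq> 0. c (inv f v # map (inv f) ys))
      = (\<Sum>v | c (v # map (inv f) ys) \<noteq> 0. c (v # map (inv f) ys))"
    by (rule sum.reindex_bij_witness[of _ f "inv f"])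
      (use f in \<open>auto simp: bij_is_inj bij_is_surj surj_f_inv_f\<close>)
  then show "boundary (relabel f c) ys = relabel f (boundary c) ys"
    by (simp add: boundary_def relabel_def)
qed

text \<open>
  Relabelling the vertices is a linear isomorphism of chain spaces that commutes with the boundary
  operator, so it carries cycles to cycles and boundaries to boundaries.
\<close>

lemma persistent_betti_relabel:
  assumes f: "bij f"
  shows "persistent_betti (F :: 'k::field itself) l ((`) f ` K) ((`) f ` L) = persistent_betti F l K L"
proof -
  let ?T = "relabel f :: (_ \<Rightarrow> 'k) \<Rightarrow> _"
  have inj: "inj ?T" by (rule inj_on_inverseI[of _ "relabel (inv f)"]) (rule relabel_inv(1)[OF f])
  have dim: "chain_dim (?T ` V) = chain_dim V" for V
    by (rule chain_dim_linear_inj_image[OF _ _ inj]) (auto simp: relabel_def chain_scale_def)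
  have "?T 0 = 0" by (simp add: relabel_def fun_eq_iff)
  then have "boundary (?T c) = 0 \<longleftrightarrow> boundary c = 0" for c
    unfolding relabel_boundary[OF f] using inj_eq[OF inj, of "boundary c" 0] by metis
  then have cyc: "cycles l ((`) f ` K) = ?T ` cycles l K"
    unfolding cycles_def relabel_chains[OF f, symmetric] by blast
  have bd: "boundaries l ((`) f ` L) = ?T ` boundaries l L"
    unfolding boundaries_def relabel_chains[OF f, symmetric]
    by (simp add: image_image relabel_boundary[OF f])
  have "cycles l ((`) f ` K) \<inter> boundaries l ((`) f ` L) = ?T ` (cycles l K \<inter> boundaries l L)"
    unfolding cyc bd by (rule image_Int[OF inj, symmetric])
  then show ?thesis by (simp add: persistent_betti_def cyc dim)
qed

section \<open>Diagrams in terms of entry radii\<close>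

text \<open>
  The radius of the smallest closed ball that contains \<open>\<sigma>\<close>, that is, the parameter at which \<open>\<sigma>\<close> enters the
  Cech filtration.
\<close>

definition cech_radius :: "'a::metric_space set \<Rightarrow> real" where
  "cech_radius \<sigma> = Inf {r. (\<Inter>x\<in>\<sigma>. cball x r) \<noteq> {}}"

text \<open>
  The infimum is attained: for radii decreasing to it the intersections of balls are nonempty nested
  compact sets. This makes the filtration continuous from the right.
\<close>

lemma Inter_cball_iff_radius_le:
  fixes \<sigma> :: "'a::heine_borel set"
  assumes \<sigma>: "finite \<sigma>" "\<sigma> \<noteq> {}"
  shows "(\<Inter>x\<in>\<sigma>. cball x r) \<noteq> {} \<longleftrightarrow> cech_radius \<sigma> \<le> r"
proof -
  let ?R = "{r. (\<Inter>x\<in>\<sigma>. cball x r) \<noteq> {}}"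
  obtain x0 where x0: "x0 \<in> \<sigma>" using \<sigma> by blast
  have bdd: "bdd_below ?R"
    by (rule bdd_belowI[of _ 0]) (use x0 in \<open>fastforce intro: order_trans[OF zero_le_dist]\<close>)
  have ne: "?R \<noteq> {}"
  proof -
    have "x0 \<in> (\<Inter>x\<in>\<sigma>. cball x (Max ((\<lambda>x. dist x x0) ` \<sigma>)))" using \<sigma> by auto
    then show ?thesis by blast
  qed
  show ?thesis
  proof
    assume "(\<Inter>x\<in>\<sigma>. cball x r) \<noteq> {}"
    then show "cech_radius \<sigma> \<le> r"
      unfolding cech_radius_def by (intro cInf_lower[OF _ bdd]) simp
  next
    assume le: "cech_radius \<sigma> \<le> r"
    define C where "C n = (\<Inter>x\<in>\<sigma>. cball x (r + 1 / real (Suc n)))" for n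
    have "\<Inter> (range C) \<noteq> {}"
    proof (rule compact_nest)
      show "compact (C n)" for n
      proof -
        have "C n = cball x0 (r + 1 / real (Suc n)) \<inter> C n" unfolding C_def using x0 by blast
        moreover have "closed (C n)" unfolding C_def by (intro closed_INT ballI closed_cball)
        ultimately show ?thesis using compact_Int_closed[OF compact_cball] by metis
      qed
      show "C n \<subseteq> C m" if "m \<le> n" for m n
      proof -
        have "1 / real (Suc n) \<le> 1 / real (Suc m)" using that by (simp add: frac_le)
        then show ?thesis unfolding C_def by (auto intro: order_trans)
      qed
      show "C n \<noteq> {}" for n
      proof -
        have "Inf ?R < r + 1 / real (Suc n)"
          using le unfolding cech_radius_def by (rule le_less_trans) simp
        then obtain s where s: "s \<in> ?R" "s < r + 1 / real (Suc n)"
          using cInf_lessD[OF ne] by blast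
        then obtain z where "z \<in> (\<Inter>x\<in>\<sigma>. cball x s)" by blast
        with s(2) have "z \<in> C n" unfolding C_def by force
        then show ?thesis by blast
      qed
    qed
    then obtain z where z: "\<And>n. z \<in> C n" by blast
    have "dist x z \<le> r" if "x \<in> \<sigma>" for x
    proof (rule field_le_epsilon)
      fix e :: real assume "e > 0"
      then obtain n where "1 / real (Suc n) < e" using nat_approx_posE by blast
      moreover have "dist x z \<le> r + 1 / real (Suc n)"
        using z[of n] that unfolding C_def by auto
      ultimately show "dist x z \<le> r + e" by linarith
    qed
    then have "z \<in> (\<Inter>x\<in>\<sigma>. cball x r)" by simp
    then show "(\<Inter>x\<in>\<sigma>. cball x r) \<noteq> {}" by blast
  qed
qed

text \<open>
  The vertex sets that homology in degree \<open>l\<close> can see.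
\<close>

definition simplices :: "nat \<Rightarrow> 'a set \<Rightarrow> 'a set set" where
  "simplices l X = {\<sigma>. \<sigma> \<subseteq> X \<and> (card \<sigma> = l + 1 \<or> card \<sigma> = l + 2)}"

text \<open>
  The complex at parameter \<open>t\<close> and the complex just before \<open>t\<close>.
\<close>

definition cech_le :: "nat \<Rightarrow> 'a::metric_space set \<Rightarrow> real \<Rightarrow> 'a set set" where
  "cech_le l X t = {\<sigma> \<in> simplices l X. cech_radius \<sigma> \<le> t}"

definition cech_lt :: "nat \<Rightarrow> 'a::metric_space set \<Rightarrow> real \<Rightarrow> 'a set set" where
  "cech_lt l X t = {\<sigma> \<in> simplices l X. cech_radius \<sigma> < t}"

text \<open>
  The alternating sum that defines the multiplicity of \<open>(b, d)\<close>, with the limit \<open>\<epsilon> \<rightarrow> 0\<close> carried out.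
\<close>

definition pd_jump :: "'k::field itself \<Rightarrow> nat \<Rightarrow> 'a::metric_space set \<Rightarrow> real \<Rightarrow> real \<Rightarrow> int" where
  "pd_jump F l X b d =
     (int (persistent_betti F l (cech_le l X b) (cech_lt l X d))
        - int (persistent_betti F l (cech_le l X b) (cech_le l X d)))
   - (int (persistent_betti F l (cech_lt l X b) (cech_lt l X d))
        - int (persistent_betti F l (cech_lt l X b) (cech_le l X d)))"

lemma finite_simplices: "finite X \<Longrightarrow> finite (simplices l X)"
  unfolding simplices_def by simp

lemma cech_le_eq:
  fixes X :: "'a::heine_borel set"
  assumes "finite X"
  shows "cech_le l X t = {\<sigma> \<in> cech X t. card \<sigma> = l + 1 \<or> card \<sigma> = l + 2}"
proof -
  have "\<sigma> \<in> cech X t \<longleftrightarrow> cech_radius \<sigma> \<le> t" if "\<sigma> \<in> simplices l X" for \<sigma>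
    using that Inter_cball_iff_radius_le[of \<sigma> t] finite_subset[OF _ assms]
    by (auto simp: cech_def simplices_def)
  then show ?thesis
    unfolding cech_le_def by (auto simp: simplices_def cech_def)
qed

lemma cech_betti_eq:
  fixes X :: "'a::heine_borel set"
  assumes "finite X"
  shows "cech_betti F l X s t = persistent_betti F l (cech_le l X s) (cech_le l X t)"
  unfolding cech_betti_def cech_le_eq[OF assms]
  by (rule persistent_betti_restrict[symmetric]) auto

text \<open>
  A finite set has finitely many entry radii, so a small enough \<open>\<epsilon>\<close> passes none of them except \<open>t\<close> itself.
\<close>

lemma eventually_cech_le:
  fixes X :: "'a::metric_space set"
  assumes "finite X"
  shows "\<forall>\<^sub>F \<epsilon> in at_right 0. cech_le l X (t + \<epsilon>) = cech_le l X t"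
    and "\<forall>\<^sub>F \<epsilon> in at_right 0. cech_le l X (t - \<epsilon>) = cech_lt l X t"
proof -
  have 1: "\<forall>\<^sub>F \<epsilon> in at_right 0. v \<le> t + \<epsilon> \<longleftrightarrow> v \<le> t" for v :: real
    by (cases "v \<le> t") (auto intro!: eventually_at_rightI[of 0 "if v \<le> t then 1 else v - t"])
  have 2: "\<forall>\<^sub>F \<epsilon> in at_right 0. v \<le> t - \<epsilon> \<longleftrightarrow> v < t" for v :: real
    by (cases "v < t") (auto intro!: eventually_at_rightI[of 0 "if v < t then t - v else 1"])
  have "\<forall>\<^sub>F \<epsilon> in at_right 0. \<forall>\<sigma>\<in>simplices l X. cech_radius \<sigma> \<le> t + \<epsilon> \<longleftrightarrow> cech_radius \<sigma> \<le> t"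
    by (intro eventually_ball_finite finite_simplices assms ballI 1)
  then show "\<forall>\<^sub>F \<epsilon> in at_right 0. cech_le l X (t + \<epsilon>) = cech_le l X t"
    by eventually_elim (auto simp: cech_le_def)
  have "\<forall>\<^sub>F \<epsilon> in at_right 0. \<forall>\<sigma>\<in>simplices l X. cech_radius \<sigma> \<le> t - \<epsilon> \<longleftrightarrow> cech_radius \<sigma> < t"
    by (intro eventually_ball_finite finite_simplices assms ballI 2)
  then show "\<forall>\<^sub>F \<epsilon> in at_right 0. cech_le l X (t - \<epsilon>) = cech_lt l X t"
    by eventually_elim (auto simp: cech_le_def cech_lt_def)
qed

lemma pd_mult_eq:
  fixes X :: "'a::heine_borel set"
  assumes X: "finite X"
  shows "pd_mult F l X (b, d) = (THE m. int m = pd_jump F l X b d)"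
proof -
  define J where "J \<epsilon> =
       (int (cech_betti F l X (b + \<epsilon>) (d - \<epsilon>)) - int (cech_betti F l X (b + \<epsilon>) (d + \<epsilon>)))
     - (int (cech_betti F l X (b - \<epsilon>) (d - \<epsilon>)) - int (cech_betti F l X (b - \<epsilon>) (d + \<epsilon>)))" for \<epsilon>
  have J: "\<forall>\<^sub>F \<epsilon> in at_right 0. J \<epsilon> = pd_jump F l X b d"
    using eventually_cech_le(1)[OF X, of l b] eventually_cech_le(2)[OF X, of l b]
      eventually_cech_le(1)[OF X, of l d] eventually_cech_le(2)[OF X, of l d]
    by eventually_elim (simp only: J_def pd_jump_def cech_betti_eq[OF X])
  have "(\<forall>\<^sub>F \<epsilon> in at_right 0. int m = J \<epsilon>) \<longleftrightarrow> int m = pd_jump F l X b d" for m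
  proof -
    have "(\<forall>\<^sub>F \<epsilon> in at_right 0. int m = J \<epsilon>) \<longleftrightarrow>
        (\<forall>\<^sub>F \<epsilon> in at_right (0::real). int m = pd_jump F l X b d)"
      using J by (intro eventually_subst) (auto elim!: eventually_mono)
    then show ?thesis by (simp add: eventually_const)
  qed
  then show ?thesis unfolding pd_mult_def J_def by simp
qed

text \<open>
  If nothing enters at \<open>b\<close>, the two rows of the alternating sum agree; if nothing enters at \<open>d\<close>, each row
  vanishes.
\<close>

lemma pd_mult_eq_0:
  fixes X :: "'a::heine_borel set"
  assumes X: "finite X" and "b \<notin> cech_radius ` simplices l X \<or> d \<notin> cech_radius ` simplices l X"
  shows "pd_mult F l X (b, d) = 0"
proof -
  have "cech_le l X b = cech_lt l X b \<or> cech_le l X d = cech_lt l X d"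
    using assms(2) unfolding cech_le_def cech_lt_def by force
  then have "pd_jump F l X b d = 0" unfolding pd_jump_def by auto
  then show ?thesis by (simp add: pd_mult_eq[OF X])
qed

text \<open>
  Only two of the four Betti numbers enter with a positive sign. The constant \<open>THE m. False\<close> is the value of the
  definite description when the alternating sum is negative, since no natural number satisfies it then.
\<close>

lemma pd_mult_le:
  fixes X :: "'a::heine_borel set"
  assumes X: "finite X"
  shows "pd_mult F l X (b, d) \<le> (THE m::nat. False) + 2 * card X ^ (l + 1)"
proof (cases "pd_jump F l X b d < 0")
  case True
  then have "int m \<noteq> pd_jump F l X b d" for m by (metis of_nat_less_0_iff)
  then have "pd_mult F l X (b, d) = (THE m::nat. False)" by (simp add: pd_mult_eq[OF X])
  then show ?thesis by simp
next
  case False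
  then have "int m = pd_jump F l X b d \<longleftrightarrow> m = nat (pd_jump F l X b d)" for m by auto
  then have "int (pd_mult F l X (b, d)) = pd_jump F l X b d" using False by (simp add: pd_mult_eq[OF X])
  moreover have "persistent_betti F l (cech_le l X b) L \<le> card X ^ (l + 1)"
     "persistent_betti F l (cech_lt l X b) L \<le> card X ^ (l + 1)" for L
    by (rule persistent_betti_le[OF X]; auto simp: cech_le_def cech_lt_def simplices_def)+
  from this(1)[of "cech_lt l X d"] this(2)[of "cech_le l X d"]
  have "pd_jump F l X b d \<le> int (2 * card X ^ (l + 1))" unfolding pd_jump_def by linarith
  ultimately show ?thesis by linarith
qed

lemma card_simplices_le:
  assumes "finite X" "X \<noteq> {}"
  shows "card (simplices l X) \<le> 2 * card X ^ (l + 2)"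
proof -
  have k: "card {\<sigma>. \<sigma> \<subseteq> X \<and> card \<sigma> = k} \<le> card X ^ k" for k
    using n_subsets[OF assms(1), of k] binomial_le_pow[of k "card X"]
    by (cases "k \<le> card X") (auto simp: binomial_eq_0)
  have "simplices l X = {\<sigma>. \<sigma> \<subseteq> X \<and> card \<sigma> = l + 1} \<union> {\<sigma>. \<sigma> \<subseteq> X \<and> card \<sigma> = l + 2}"
    by (auto simp: simplices_def)
  then have "card (simplices l X) \<le> card X ^ (l + 1) + card X ^ (l + 2)"
    by (metis (no_types) order_trans[OF card_Un_le add_mono[OF k k]])
  also have "card X ^ (l + 1) \<le> card X ^ (l + 2)"
    using assms by (intro power_increasing) (auto simp: Suc_le_eq card_gt_0_iff)
  finally show ?thesis by simp
qed

definition crit_pairs :: "nat \<Rightarrow> 'a::metric_space set \<Rightarrow> (real \<times> real) set" where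
  "crit_pairs l X = (cech_radius ` simplices l X) \<times> (cech_radius ` simplices l X)"

lemma count_Dgm:
  fixes X :: "'a::heine_borel set"
  assumes X: "finite X"
  shows "count (Dgm F l X) p = (if p \<in> Delta then pd_mult F l X p else 0)"
proof -
  have *: "p \<in> crit_pairs l X" if "pd_mult F l X p \<noteq> 0" for p
    using that pd_mult_eq_0[OF X, of "fst p" l "snd p" F] unfolding crit_pairs_def mem_Times_iff by auto
  have "finite {p. 0 < (if p \<in> Delta then pd_mult F l X p else 0)}"
  proof (rule finite_subset)
    show "{p. 0 < (if p \<in> Delta then pd_mult F l X p else 0)} \<subseteq> crit_pairs l X"
      using * by (auto split: if_splits)
  qed (simp add: crit_pairs_def finite_simplices[OF X])
  then show ?thesis unfolding Dgm_def by (subst count_Abs_multiset) auto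
qed

lemma sum_mset_eq_sum_count:
  fixes f :: "'b \<Rightarrow> 'c::comm_semiring_1"
  assumes "finite C" "set_mset D \<subseteq> C"
  shows "(\<Sum>x\<in>#D. f x) = (\<Sum>x\<in>C. of_nat (count D x) * f x)"
  using assms(2)
proof (induction D)
  case (add x D)
  have "(\<Sum>y\<in>C. of_nat (count (add_mset x D) y) * f y)
      = (\<Sum>y\<in>C. of_nat (count D y) * f y + (if y = x then f y else 0))"
    by (intro sum.cong) (auto simp: algebra_simps)
  also have "\<dots> = (\<Sum>y\<in>C. of_nat (count D y) * f y) + f x"
    using add.prems assms(1) by (simp add: sum.distrib)
  finally show ?case using add by (simp add: add.commute)
qed simp

lemma sum_mset_Dgm:
  fixes X :: "'a::heine_borel set" and f :: "real \<times> real \<Rightarrow> 'c::comm_semiring_1"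
  assumes X: "finite X"
  shows "(\<Sum>p\<in>#Dgm F l X. f p) = (\<Sum>p\<in>crit_pairs l X. if p \<in> Delta then of_nat (pd_mult F l X p) * f p else 0)"
proof -
  have "p \<in> crit_pairs l X" if "p \<in># Dgm F l X" for p
    using that pd_mult_eq_0[OF X, of "fst p" l "snd p" F]
    unfolding count_greater_zero_iff[symmetric] count_Dgm[OF X] crit_pairs_def mem_Times_iff
    by (auto split: if_splits)
  then have "(\<Sum>p\<in>#Dgm F l X. f p) = (\<Sum>p\<in>crit_pairs l X. of_nat (count (Dgm F l X) p) * f p)"
    by (intro sum_mset_eq_sum_count) (auto simp: crit_pairs_def finite_simplices[OF X])
  also have "\<dots> = (\<Sum>p\<in>crit_pairs l X. if p \<in> Delta then of_nat (pd_mult F l X p) * f p else 0)"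
    by (intro sum.cong refl) (simp add: count_Dgm[OF X])
  finally show ?thesis .
qed

text \<open>
  There are at most \<open>(2 N\<^sup>l\<^sup>+\<^sup>2)\<^sup>2\<close> pairs of entry radii, and each has multiplicity at most a constant times
  \<open>N\<^sup>l\<^sup>+\<^sup>1\<close>.
\<close>

lemma size_Dgm_le:
  fixes X :: "'a::heine_borel set"
  assumes X: "finite X"
  shows "size (Dgm F l X) \<le> 4 * ((THE m::nat. False) + 2) * card X ^ (3 * l + 5)"
proof (cases "X = {}")
  case True
  then have "simplices l X = {}" by (auto simp: simplices_def)
  then have "size (Dgm F l X) = 0"
    unfolding size_eq_sum_mset sum_mset_Dgm[OF X] by (simp add: crit_pairs_def)
  then show ?thesis by simp
next
  case False
  let ?N = "card X" and ?c = "THE m::nat. False"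
  have N: "?N \<ge> 1" using X False by (simp add: Suc_le_eq card_gt_0_iff)
  have "size (Dgm F l X) = (\<Sum>p\<in>crit_pairs l X. if p \<in> Delta then pd_mult F l X p else 0)"
    unfolding size_eq_sum_mset sum_mset_Dgm[OF X] mult_1_right of_nat_id ..
  also have "\<dots> \<le> (\<Sum>p\<in>crit_pairs l X. ?c + 2 * ?N ^ (l + 1))"
  proof (rule sum_mono)
    fix p
    show "(if p \<in> Delta then pd_mult F l X p else 0) \<le> ?c + 2 * ?N ^ (l + 1)"
      using pd_mult_le[OF X, of F l "fst p" "snd p"] by simp
  qed
  also have "\<dots> = card (crit_pairs l X) * (?c + 2 * ?N ^ (l + 1))" by simp
  also have "\<dots> \<le> (2 * ?N ^ (l + 2)) * (2 * ?N ^ (l + 2)) * ((?c + 2) * ?N ^ (l + 1))"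
  proof (rule mult_mono)
    have "card (cech_radius ` simplices l X) \<le> 2 * ?N ^ (l + 2)"
      using card_image_le[OF finite_simplices[OF X]] card_simplices_le[OF X False] by (rule order_trans)
    then show "card (crit_pairs l X) \<le> (2 * ?N ^ (l + 2)) * (2 * ?N ^ (l + 2))"
      unfolding crit_pairs_def card_cartesian_product by (intro mult_mono) auto
    have "?c * 1 \<le> ?c * ?N ^ (l + 1)" using N by (intro mult_left_mono one_le_power) auto
    then show "?c + 2 * ?N ^ (l + 1) \<le> (?c + 2) * ?N ^ (l + 1)" unfolding distrib_right by linarith
  qed auto
  also have "\<dots> = 4 * (?c + 2) * (?N ^ (l + 2) * ?N ^ (l + 2) * ?N ^ (l + 1))"
    by (simp only: mult.assoc mult.left_commute mult.commute)
  also have "\<dots> = 4 * (?c + 2) * ?N ^ (3 * l + 5)"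
  proof -
    have "3 * l + 5 = (l + 2) + (l + 2) + (l + 1)" by simp
    then show ?thesis by (simp only: power_add)
  qed
  finally show ?thesis .
qed

lemma simplices_image:
  assumes "inj_on f X"
  shows "simplices l (f ` X) = (`) f ` simplices l X"
proof -
  have "card (f ` \<sigma>) = card \<sigma>" if "\<sigma> \<subseteq> X" for \<sigma>
    by (intro card_image inj_on_subset[OF assms that])
  then show ?thesis unfolding simplices_def subset_image_iff by auto
qed

lemma pd_mult_relabel:
  fixes X :: "'a::heine_borel set" and f :: "'a \<Rightarrow> 'a"
  assumes f: "bij f" and X: "finite X"
    and b: "\<And>\<sigma>. \<sigma> \<in> simplices l X \<Longrightarrow> cech_radius (f ` \<sigma>) \<le> b' \<longleftrightarrow> cech_radius \<sigma> \<le> b"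
      "\<And>\<sigma>. \<sigma> \<in> simplices l X \<Longrightarrow> cech_radius (f ` \<sigma>) < b' \<longleftrightarrow> cech_radius \<sigma> < b"
    and d: "\<And>\<sigma>. \<sigma> \<in> simplices l X \<Longrightarrow> cech_radius (f ` \<sigma>) \<le> d' \<longleftrightarrow> cech_radius \<sigma> \<le> d"
      "\<And>\<sigma>. \<sigma> \<in> simplices l X \<Longrightarrow> cech_radius (f ` \<sigma>) < d' \<longleftrightarrow> cech_radius \<sigma> < d"
  shows "pd_mult F l (f ` X) (b', d') = pd_mult F l X (b, d)"
proof -
  have s: "simplices l (f ` X) = (`) f ` simplices l X"
    by (rule simplices_image[OF inj_on_subset[OF bij_is_inj[OF f] subset_UNIV]])
  have "cech_le l (f ` X) b' = (`) f ` cech_le l X b" "cech_lt l (f ` X) b' = (`) f ` cech_lt l X b"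
    "cech_le l (f ` X) d' = (`) f ` cech_le l X d" "cech_lt l (f ` X) d' = (`) f ` cech_lt l X d"
    unfolding cech_le_def cech_lt_def s using b d by blast+
  then have "pd_jump F l (f ` X) b' d' = pd_jump F l X b d"
    unfolding pd_jump_def by (simp add: persistent_betti_relabel[OF f])
  then show ?thesis using X by (simp only: pd_mult_eq finite_imageI)
qed

text \<open>
  Since \<open>S\<close> and \<open>T\<close> are finite of the same size, so are \<open>S - T\<close> and \<open>T - S\<close>; a bijection
  from \<open>T - S\<close> to \<open>S - T\<close> closes up the given map to a permutation of \<open>S \<union> T\<close>.
\<close>

lemma bij_betw_finite_extend:
  fixes f :: "'a \<Rightarrow> 'a"
  assumes S: "finite S" and f: "bij_betw f S T"
  obtains g where "bij g" "\<And>x. x \<in> S \<Longrightarrow> g x = f x"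
proof -
  have T: "finite T" using f S bij_betw_finite by blast
  have "card (T - S) = card (S - T)"
    using card_le_sym_Diff[of S T] card_le_sym_Diff[of T S] S T bij_betw_same_card[OF f] by simp
  then obtain h where h: "bij_betw h (T - S) (S - T)"
    using S T by (metis finite_Diff finite_same_card_bij)
  define g where "g x = (if x \<in> S then f x else if x \<in> T then h x else x)" for x
  have "bij_betw g S T" using f by (rule bij_betw_cong[THEN iffD1, rotated]) (simp add: g_def)
  moreover have "bij_betw g (T - S) (S - T)"
    using h by (rule bij_betw_cong[THEN iffD1, rotated]) (simp add: g_def)
  ultimately have "bij_betw g (S \<union> (T - S)) (T \<union> (S - T))" by (rule bij_betw_combine) blast
  moreover have "bij_betw g (- (S \<union> T)) (- (S \<union> T))"
    using bij_betw_id by (rule bij_betw_cong[THEN iffD1, rotated]) (simp add: g_def)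
  ultimately have "bij_betw g (S \<union> (T - S) \<union> - (S \<union> T)) (T \<union> (S - T) \<union> - (S \<union> T))"
    by (rule bij_betw_combine) blast
  moreover have "S \<union> (T - S) \<union> - (S \<union> T) = UNIV" "T \<union> (S - T) \<union> - (S \<union> T) = UNIV" by blast+
  ultimately have "bij g" by simp
  then show ?thesis by (rule that) (simp add: g_def)
qed

section \<open>Atoms of integer-valued random measures\<close>

lemma bounded_borel_Int: "A \<in> bounded_borel \<Longrightarrow> B \<in> sets borel \<Longrightarrow> A \<inter> B \<in> bounded_borel"
  unfolding bounded_borel_def by (auto intro: bounded_subset)

lemma
  fixes f :: "'a::euclidean_space \<Rightarrow> real"
  shows space_bf_borel: "space bf_borel = (boundedly_finite :: 'a measure set)"
  and integral_set_in_bf_borel: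
    "continuous_on UNIV f \<Longrightarrow> bounded {x. f x \<noteq> 0} \<Longrightarrow> open U \<Longrightarrow>
      {\<mu> \<in> boundedly_finite. integral\<^sup>L \<mu> f \<in> U} \<in> sets bf_borel"
proof -
  have sub: "{U. openin wsharp_topology U} \<subseteq> Pow (boundedly_finite :: 'a measure set)"
  proof
    fix U :: "'a measure set" assume "U \<in> {U. openin wsharp_topology U}"
    then have "U \<subseteq> topspace wsharp_topology" using openin_subset by blast
    then show "U \<in> Pow boundedly_finite"
      unfolding wsharp_topology_def topology_generated_by_topspace by blast
  qed
  show "space bf_borel = (boundedly_finite :: 'a measure set)"
    unfolding bf_borel_def by (rule space_measure_of[OF sub])
  assume "continuous_on UNIV f" "bounded {x. f x \<noteq> 0}" "open U"
  then have "openin wsharp_topology {\<mu> \<in> boundedly_finite. integral\<^sup>L \<mu> f \<in> U}"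
    unfolding wsharp_topology_def
    by (intro topology_generated_by_Basis) blast
  then show "{\<mu> \<in> boundedly_finite. integral\<^sup>L \<mu> f \<in> U} \<in> sets bf_borel"
    unfolding bf_borel_def sets_measure_of[OF sub] by (intro sigma_sets.Basic) simp
qed

context
  fixes P :: "'w measure" and \<xi> :: "'w \<Rightarrow> 'a::euclidean_space measure"
  assumes \<xi>: "\<xi> \<in> measurable P bf_borel"
begin

lemma random_measure_boundedly_finite: "\<omega> \<in> space P \<Longrightarrow> \<xi> \<omega> \<in> boundedly_finite"
  using measurable_space[OF \<xi>] by (simp add: space_bf_borel)

lemma sets_random_measure: "\<omega> \<in> space P \<Longrightarrow> sets (\<xi> \<omega>) = sets borel"
  using random_measure_boundedly_finite by (auto simp: boundedly_finite_def)

lemma emeasure_random_measure_finite: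
  "\<omega> \<in> space P \<Longrightarrow> A \<in> bounded_borel \<Longrightarrow> emeasure (\<xi> \<omega>) A < \<infinity>"
  using random_measure_boundedly_finite by (auto simp: boundedly_finite_def)

lemma integral_random_measure_measurable:
  fixes f :: "'a \<Rightarrow> real"
  assumes "continuous_on UNIV f" "bounded {x. f x \<noteq> 0}"
  shows "(\<lambda>\<omega>. integral\<^sup>L (\<xi> \<omega>) f) \<in> borel_measurable P"
proof (rule borel_measurableI)
  fix U :: "real set" assume "open U"
  have "(\<lambda>\<omega>. integral\<^sup>L (\<xi> \<omega>) f) -` U \<inter> space P
      = \<xi> -` {\<mu> \<in> boundedly_finite. integral\<^sup>L \<mu> f \<in> U} \<inter> space P"
    using random_measure_boundedly_finite by auto
  then show "(\<lambda>\<omega>. integral\<^sup>L (\<xi> \<omega>) f) -` U \<inter> space P \<in> sets P"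
    using measurable_sets[OF \<xi> integral_set_in_bf_borel[OF assms \<open>open U\<close>]] by simp
qed

text \<open>
  The vague topology only provides integrals of continuous functions; the indicator of a compact set
  is the limit of continuous functions with a common bounded support.
\<close>

lemma emeasure_compact_measurable:
  assumes C: "compact C"
  shows "(\<lambda>\<omega>. emeasure (\<xi> \<omega>) C) \<in> borel_measurable P"
proof (cases "C = {}")
  case False
  obtain R where R: "\<And>x. x \<in> C \<Longrightarrow> norm x \<le> R"
    using compact_imp_bounded[OF C] unfolding bounded_iff by blast
  define f :: "nat \<Rightarrow> 'a \<Rightarrow> real" where "f n x = max 0 (1 - real (Suc n) * infdist x C)" for n x
  have f0: "f n x = 0" if "x \<notin> cball 0 (R + 1)" for n x
  proof -
    have "infdist x C \<ge> 1"
    proof (rule ccontr)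
      assume "\<not> infdist x C \<ge> 1"
      moreover obtain c where "c \<in> C" "infdist x C = dist x c"
        using infdist_attains_inf[OF compact_imp_closed[OF C] False] by blast
      ultimately have "norm x \<le> R + 1"
        using R[of c] norm_triangle_ineq2[of x c] by (simp add: dist_norm)
      with that show False by simp
    qed
    then have "1 * 1 \<le> real (Suc n) * infdist x C" by (intro mult_mono) auto
    then show ?thesis by (simp add: f_def)
  qed
  have f_cont: "continuous_on UNIV (f n)" for n
    unfolding f_def by (intro continuous_intros)
  have f_supp: "bounded {x. f n x \<noteq> 0}" for n
    by (rule bounded_subset[OF bounded_cball[of 0 "R + 1"]]) (use f0 in blast)
  have f_lim: "(\<lambda>n. f n x) \<longlonglongrightarrow> indicator C x" for x
  proof (cases "x \<in> C")
    case True
    then show ?thesis by (simp add: f_def)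
  next
    case x: False
    have pos: "infdist x C > 0"
      using x False C by (simp add: compact_imp_closed infdist_pos_not_in_closed)
    then obtain m where m: "1 / real (Suc m) < infdist x C" using nat_approx_posE by blast
    have "f n x = 0" if "n \<ge> m" for n
    proof -
      have "1 = real (Suc m) * (1 / real (Suc m))" by simp
      also have "\<dots> \<le> real (Suc n) * infdist x C" using m that pos by (intro mult_mono) auto
      finally show ?thesis by (simp add: f_def)
    qed
    then have "\<forall>\<^sub>F n in sequentially. f n x = indicator C x"
      using x by (auto simp: eventually_sequentially)
    then show ?thesis by (rule tendsto_eventually)
  qed
  have "(\<lambda>n. integral\<^sup>L (\<xi> \<omega>) (f n)) \<longlonglongrightarrow> measure (\<xi> \<omega>) C" if \<omega>: "\<omega> \<in> space P" for \<omega>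
  proof -
    note [measurable_cong] = sets_random_measure[OF \<omega>]
    have [measurable]: "C \<in> sets borel" using C by (simp add: borel_compact)
    have [measurable]: "f n \<in> borel_measurable borel" for n
      by (rule borel_measurable_continuous_onI[OF f_cont])
    have "emeasure (\<xi> \<omega>) (cball 0 (R + 1)) < \<infinity>"
      by (rule emeasure_random_measure_finite[OF \<omega>]) (simp add: bounded_borel_def)
    then have "integrable (\<xi> \<omega>) (indicator (cball 0 (R + 1)) :: 'a \<Rightarrow> real)"
      by (intro integrable_real_indicator) auto
    moreover have "norm (f n x) \<le> indicator (cball 0 (R + 1)) x" for n x
      using f0[of x n] infdist_nonneg[of x C] by (cases "x \<in> cball 0 (R + 1)") (auto simp: f_def)
    ultimately have "(\<lambda>n. integral\<^sup>L (\<xi> \<omega>) (f n)) \<longlonglongrightarrow> integral\<^sup>L (\<xi> \<omega>) (indicator C :: 'a \<Rightarrow> real)"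
      by (intro integral_dominated_convergence[where w = "indicator (cball 0 (R + 1))"])
         (auto intro: f_lim)
    then show ?thesis using sets_eq_imp_space_eq[OF sets_random_measure[OF \<omega>]] by simp
  qed
  then have "(\<lambda>\<omega>. measure (\<xi> \<omega>) C) \<in> borel_measurable P"
    by (rule borel_measurable_LIMSEQ_real[OF _ integral_random_measure_measurable[OF f_cont f_supp]])
  then have "(\<lambda>\<omega>. ennreal (measure (\<xi> \<omega>) C)) \<in> borel_measurable P" by measurable
  moreover have "emeasure (\<xi> \<omega>) C = ennreal (measure (\<xi> \<omega>) C)" if "\<omega> \<in> space P" for \<omega>
    using emeasure_random_measure_finite[OF that, of C] C
    by (intro emeasure_eq_ennreal_measure)
       (auto simp: bounded_borel_def borel_compact compact_imp_bounded)
  ultimately show ?thesis by (simp cong: measurable_cong)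
qed simp

text \<open>
  From compact to bounded Borel sets by the \<open>\<pi>\<close>-\<open>\<lambda>\<close> theorem, applied inside a ball so that
  complements have finite mass.
\<close>

lemma emeasure_random_measure_measurable:
  assumes "B \<in> bounded_borel"
  shows "(\<lambda>\<omega>. emeasure (\<xi> \<omega>) B) \<in> borel_measurable P"
proof -
  obtain R where R: "B \<subseteq> cball 0 R"
    using assms unfolding bounded_borel_def bounded_iff subset_iff mem_cball_0 by blast
  let ?K = "cball 0 R :: 'a set"
  have fin: "emeasure (\<xi> \<omega>) (D \<inter> ?K) < \<infinity>" if "\<omega> \<in> space P" "D \<in> sets borel" for \<omega> D
    using that by (intro emeasure_random_measure_finite) (auto simp: bounded_borel_def)
  have "sigma_sets UNIV {S :: 'a set. closed S} = sets borel"
    by (simp add: borel_eq_closed)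
  then have "B \<in> sigma_sets UNIV {S. closed S}" using assms by (simp add: bounded_borel_def)
  then have "(\<lambda>\<omega>. emeasure (\<xi> \<omega>) (B \<inter> ?K)) \<in> borel_measurable P"
  proof (rule sigma_sets_induct_disjoint[rotated 2])
    show "Int_stable {S :: 'a set. closed S}" by (auto simp: Int_stable_def)
    show "{S :: 'a set. closed S} \<subseteq> Pow UNIV" by simp
    show "(\<lambda>\<omega>. emeasure (\<xi> \<omega>) (D \<inter> ?K)) \<in> borel_measurable P" if "D \<in> {S. closed S}" for D
      using that by (intro emeasure_compact_measurable closed_Int_compact) auto
    show "(\<lambda>\<omega>. emeasure (\<xi> \<omega>) ({} \<inter> ?K)) \<in> borel_measurable P" by simp
    show "(\<lambda>\<omega>. emeasure (\<xi> \<omega>) ((UNIV - D) \<inter> ?K)) \<in> borel_measurable P"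
      if D: "D \<in> sigma_sets UNIV {S. closed S}"
        and m: "(\<lambda>\<omega>. emeasure (\<xi> \<omega>) (D \<inter> ?K)) \<in> borel_measurable P" for D
    proof -
      have D': "D \<in> sets borel" using D by (simp add: borel_eq_closed)
      have "emeasure (\<xi> \<omega>) ((UNIV - D) \<inter> ?K) = emeasure (\<xi> \<omega>) ?K - emeasure (\<xi> \<omega>) (D \<inter> ?K)"
        if \<omega>: "\<omega> \<in> space P" for \<omega>
      proof -
        have "(UNIV - D) \<inter> ?K = ?K - D \<inter> ?K" by blast
        then show ?thesis
          using fin[OF \<omega> D'] D' by (simp only:) (intro emeasure_Diff, auto simp: sets_random_measure[OF \<omega>])
      qed
      moreover have "(\<lambda>\<omega>. emeasure (\<xi> \<omega>) ?K - emeasure (\<xi> \<omega>) (D \<inter> ?K)) \<in> borel_measurable P"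
        using emeasure_compact_measurable[OF compact_cball] m by measurable
      ultimately show ?thesis by (simp cong: measurable_cong)
    qed
    show "(\<lambda>\<omega>. emeasure (\<xi> \<omega>) (\<Union> (range D) \<inter> ?K)) \<in> borel_measurable P"
      if dis: "disjoint_family D" and D: "range D \<subseteq> sigma_sets UNIV {S. closed S}"
        and m: "\<And>i. (\<lambda>\<omega>. emeasure (\<xi> \<omega>) (D i \<inter> ?K)) \<in> borel_measurable P" for D :: "nat \<Rightarrow> 'a set"
    proof -
      have D': "D i \<in> sets borel" for i using D by (auto simp: borel_eq_closed)
      have "emeasure (\<xi> \<omega>) (\<Union> (range D) \<inter> ?K) = (\<Sum>i. emeasure (\<xi> \<omega>) (D i \<inter> ?K))"
        if \<omega>: "\<omega> \<in> space P" for \<omega>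
      proof -
        have "\<Union> (range D) \<inter> ?K = (\<Union>i. D i \<inter> ?K)" by blast
        moreover have "disjoint_family (\<lambda>i. D i \<inter> ?K)" using dis by (auto simp: disjoint_family_on_def)
        ultimately show ?thesis
          using D' by (simp only:) (intro suminf_emeasure[symmetric], auto simp: sets_random_measure[OF \<omega>])
      qed
      moreover have "(\<lambda>\<omega>. \<Sum>i. emeasure (\<xi> \<omega>) (D i \<inter> ?K)) \<in> borel_measurable P"
        using m by measurable
      ultimately show ?thesis by (simp cong: measurable_cong)
    qed
  qed
  then show ?thesis using R by (simp add: Int_absorb2)
qed

end

definition integer_valued_measure :: "'a::euclidean_space measure \<Rightarrow> bool" where
  "integer_valued_measure \<mu> \<longleftrightarrow> \<mu> \<in> boundedly_finite \<and> (\<forall>A\<in>bounded_borel. emeasure \<mu> A \<in> \<nat>)"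

context
  fixes \<mu> :: "'a::euclidean_space measure"
  assumes \<mu>: "integer_valued_measure \<mu>"
begin

lemma integer_valued_measure_sets [measurable_cong]: "sets \<mu> = sets borel"
  and integer_valued_measure_finite: "A \<in> bounded_borel \<Longrightarrow> emeasure \<mu> A < \<infinity>"
  using \<mu> by (auto simp: integer_valued_measure_def boundedly_finite_def)

lemma integer_valued_measure_ge_1:
  assumes "A \<in> bounded_borel" "emeasure \<mu> A \<noteq> 0" shows "1 \<le> emeasure \<mu> A"
proof -
  obtain n where "emeasure \<mu> A = of_nat n"
    using \<mu> assms by (auto simp: integer_valued_measure_def elim: Nats_cases)
  then show ?thesis using assms(2) by (cases n) auto
qed

lemma finite_atoms:
  assumes A: "A \<in> bounded_borel"
  shows "finite (atoms \<mu> A)" and "of_nat (card (atoms \<mu> A)) \<le> emeasure \<mu> A"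
proof -
  obtain n where n: "emeasure \<mu> A = of_nat n"
    using \<mu> A by (auto simp: integer_valued_measure_def elim: Nats_cases)
  have "card S \<le> n" if S: "S \<subseteq> atoms \<mu> A" "finite S" for S
  proof -
    have "of_nat (card S) = (\<Sum>x\<in>S. (1::ennreal))" by simp
    also have "\<dots> \<le> (\<Sum>x\<in>S. emeasure \<mu> {x})"
      using S by (intro sum_mono integer_valued_measure_ge_1) (auto simp: atoms_def bounded_borel_def)
    also have "\<dots> = emeasure \<mu> S"
      by (rule emeasure_eq_sum_singleton[symmetric]) (auto simp: S integer_valued_measure_sets)
    also have "\<dots> \<le> emeasure \<mu> A"
      using S A by (intro emeasure_mono) (auto simp: atoms_def bounded_borel_def integer_valued_measure_sets)
    finally show ?thesis by (simp add: n)
  qed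
  from finite_if_finite_subsets_card_bdd[OF this]
  show "finite (atoms \<mu> A)" "of_nat (card (atoms \<mu> A)) \<le> emeasure \<mu> A" by (auto simp: n)
qed

text \<open>
  If \<open>x\<close> is not an atom, the masses of small balls around \<open>x\<close> tend to \<open>0\<close>, and being
  integers they vanish eventually. Without atoms the set \<open>A\<close> is therefore covered by null sets, of
  which countably many basis sets suffice.
\<close>

lemma emeasure_pos_iff_atom:
  assumes A: "A \<in> bounded_borel"
  shows "emeasure \<mu> A > 0 \<longleftrightarrow> atoms \<mu> A \<noteq> {}"
proof
  assume "atoms \<mu> A \<noteq> {}"
  then obtain x where x: "x \<in> A" "emeasure \<mu> {x} > 0" unfolding atoms_def by blast
  have "emeasure \<mu> {x} \<le> emeasure \<mu> A"
    using x A by (intro emeasure_mono) (auto simp: bounded_borel_def integer_valued_measure_sets)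
  with x show "emeasure \<mu> A > 0" by (rule_tac less_le_trans)
next
  assume pos: "emeasure \<mu> A > 0"
  have [measurable]: "A \<in> sets borel" using A by (simp add: bounded_borel_def)
  show "atoms \<mu> A \<noteq> {}"
  proof
    assume no: "atoms \<mu> A = {}"
    obtain \<B> :: "'a set set" where \<B>: "countable \<B>" "topological_basis \<B>"
      using ex_countable_basis by blast
    define \<N> where "\<N> = {U \<in> \<B>. emeasure \<mu> (A \<inter> U) = 0}"
    have null: "\<exists>U\<in>\<N>. x \<in> U" if x: "x \<in> A" for x
    proof -
      let ?D = "\<lambda>n. A \<inter> ball x (1 / real (Suc n))"
      have bb: "?D n \<in> bounded_borel" for n using A by (intro bounded_borel_Int) auto
      have "(\<lambda>n. emeasure \<mu> (?D n)) \<longlonglongrightarrow> emeasure \<mu> (\<Inter>n. ?D n)"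
      proof (rule Lim_emeasure_decseq)
        show "range ?D \<subseteq> sets \<mu>" by (auto simp: integer_valued_measure_sets)
        show "decseq ?D"
        proof (rule decseq_SucI)
          fix n
          have "1 / real (Suc (Suc n)) \<le> 1 / real (Suc n)" by (simp add: frac_le)
          then show "?D (Suc n) \<subseteq> ?D n" by (intro Int_mono subset_ball order_refl)
        qed
        show "emeasure \<mu> (?D n) \<noteq> \<infinity>" for n using integer_valued_measure_finite[OF bb[of n]] by simp
      qed
      moreover have "(\<Inter>n. ?D n) = {x}"
      proof -
        have "y = x" if "\<And>n. dist x y < 1 / real (Suc n)" for y
        proof (rule ccontr)
          assume "y \<noteq> x"
          then obtain n where "1 / real (Suc n) < dist x y" using nat_approx_posE[of "dist x y"] by auto
          with that[of n] show False by simp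
        qed
        then show ?thesis using x by auto
      qed
      moreover have "emeasure \<mu> {x} = 0" using no x by (auto simp: atoms_def)
      ultimately have "\<forall>\<^sub>F n in sequentially. emeasure \<mu> (?D n) < 1"
        by (metis order_tendstoD(2) zero_less_one)
      then obtain n where n: "emeasure \<mu> (?D n) < 1" by (auto simp: eventually_sequentially)
      then have n0: "emeasure \<mu> (?D n) = 0" using integer_valued_measure_ge_1[OF bb] by fastforce
      obtain U where U: "U \<in> \<B>" "x \<in> U" "U \<subseteq> ball x (1 / real (Suc n))"
        using topological_basisE[OF \<B>(2) open_ball, of x x "1 / real (Suc n)"] by auto
      have "emeasure \<mu> (A \<inter> U) \<le> emeasure \<mu> (?D n)"
        using U by (intro emeasure_mono) (auto simp: integer_valued_measure_sets)
      with n0 U show ?thesis by (auto simp: \<N>_def)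
    qed
    have "(\<Union>U\<in>\<N>. A \<inter> U) \<in> null_sets \<mu>"
    proof (rule null_sets_UN')
      show "countable \<N>" using \<B>(1) by (simp add: \<N>_def)
      show "A \<inter> U \<in> null_sets \<mu>" if "U \<in> \<N>" for U
        using that topological_basis_open[OF \<B>(2)]
        by (auto simp: \<N>_def null_sets_def integer_valued_measure_sets)
    qed
    moreover have "(\<Union>U\<in>\<N>. A \<inter> U) = A" using null by blast
    ultimately have "A \<in> null_sets \<mu>" by metis
    then show False using pos by (simp add: null_setsD1)
  qed
qed

end

lemma separated_basis_sets:
  fixes X :: "'a::metric_space set"
  assumes X: "finite X" and \<B>: "topological_basis \<B>"
  obtains us where "length us = card X" "set us \<subseteq> \<B>" "\<And>u. u \<in> set us \<Longrightarrow> X \<inter> u \<noteq> {}"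
    "\<And>i j. i < j \<Longrightarrow> j < length us \<Longrightarrow> us ! i \<inter> us ! j = {}"
proof -
  obtain xs where xs: "set xs = X" "distinct xs" using finite_distinct_list[OF X] by blast
  obtain e where e: "e > 0" "\<And>x y. x \<in> X \<Longrightarrow> y \<in> X \<Longrightarrow> x \<noteq> y \<Longrightarrow> e \<le> dist x y"
  proof -
    let ?D = "insert 1 ((\<lambda>(x, y). dist x y) ` {(x, y) \<in> X \<times> X. x \<noteq> y})"
    have "finite {(x, y) \<in> X \<times> X. x \<noteq> y}" by (rule finite_subset[of _ "X \<times> X"]) (use X in auto)
    then have fin: "finite ?D" by blast
    show ?thesis
    proof (rule that[of "Min ?D"])
      show "Min ?D > 0" using fin by (subst Min_gr_iff) auto
      show "Min ?D \<le> dist x y" if "x \<in> X" "y \<in> X" "x \<noteq> y" for x y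
        using that fin by (intro Min_le) auto
    qed
  qed
  have "\<exists>U. U \<in> \<B> \<and> x \<in> U \<and> U \<subseteq> ball x (e / 2)" for x
    using topological_basisE[OF \<B> open_ball, of x x "e / 2"] e(1) by auto
  then obtain U where U: "\<And>x. U x \<in> \<B>" "\<And>x. x \<in> U x" "\<And>x. U x \<subseteq> ball x (e / 2)" by metis
  show ?thesis
  proof (rule that[of "map U xs"])
    show "length (map U xs) = card X" using xs distinct_card by fastforce
    show "set (map U xs) \<subseteq> \<B>" using U by auto
    show "X \<inter> u \<noteq> {}" if "u \<in> set (map U xs)" for u using that U(2) xs by auto
    show "map U xs ! i \<inter> map U xs ! j = {}" if ij: "i < j" "j < length (map U xs)" for i j
    proof -
      have "xs ! i \<noteq> xs ! j" using ij xs(2) by (simp add: nth_eq_iff_index_eq)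
      then have "e \<le> dist (xs ! i) (xs ! j)" using ij xs(1) by (intro e(2)) auto
      then have "ball (xs ! i) (e / 2) \<inter> ball (xs ! j) (e / 2) = {}"
        by (intro disjoint_ballI) simp
      then show ?thesis using U(3)[of "xs ! i"] U(3)[of "xs ! j"] ij by auto
    qed
  qed
qed

text \<open>
  The pigeonhole principle: disjoint cells that each meet \<open>X\<close>, as many as \<open>X\<close> has points.
\<close>

lemma one_point_per_cell:
  assumes X: "finite X" and us: "length us = card X" "\<And>i. i < card X \<Longrightarrow> X \<inter> us ! i \<noteq> {}"
    and dis: "\<And>i j. i < j \<Longrightarrow> j < length us \<Longrightarrow> us ! i \<inter> us ! j = {}"
    and x: "\<And>i. i < card X \<Longrightarrow> x i \<in> X \<inter> us ! i"
  shows "inj_on x {..<card X}" "x ` {..<card X} = X"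
    "i < card X \<Longrightarrow> y \<in> X \<inter> us ! i \<Longrightarrow> y = x i"
proof -
  have dis': "us ! i \<inter> us ! j = {}" if "i \<noteq> j" "i < card X" "j < card X" for i j
    using that dis[of i j] dis[of j i] us(1) by (metis Int_commute nat_neq_iff)
  show inj: "inj_on x {..<card X}"
  proof (rule inj_onI)
    fix i j assume "i \<in> {..<card X}" "j \<in> {..<card X}" "x i = x j"
    then show "i = j" using x[of i] x[of j] dis'[of i j] by auto
  qed
  show img: "x ` {..<card X} = X"
    using x by (intro card_subset_eq[OF X]) (auto simp: card_image[OF inj])
  show "y = x i" if i: "i < card X" and y: "y \<in> X \<inter> us ! i"
  proof -
    obtain j where j: "j < card X" "y = x j" using y img by blast
    then show ?thesis using dis'[of i j] x[of j] y i by auto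
  qed
qed

text \<open>
  The events are indexed by lists of disjoint basis sets: the event of a list says that each of its
  members contains an atom and that no longer list has this property. Then the list is as long as there are
  atoms, each member contains exactly one atom, and whether the \<open>i\<close>-th atom lies in \<open>C\<close> can be read off
  from the mass of the \<open>i\<close>-th member intersected with \<open>C\<close>.
\<close>

lemma measurable_enumeration_of_atoms:
  fixes \<xi> :: "'w \<Rightarrow> 'a::euclidean_space measure"
  assumes \<xi>: "\<xi> \<in> measurable P bf_borel"
    and count: "\<And>\<omega>. \<omega> \<in> space P \<Longrightarrow> integer_valued_measure (\<xi> \<omega>)"
    and A: "A \<in> bounded_borel"
  obtains \<E> where "countable \<E>" "\<E> \<subseteq> sets P" "space P \<subseteq> \<Union>\<E>"
    "\<And>E. E \<in> \<E> \<Longrightarrow> \<exists>(N::nat) x. (\<forall>i<N. x i \<in> borel_measurable (restrict_space P E)) \<and>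
       (\<forall>\<omega>\<in>E. inj_on (\<lambda>i. x i \<omega>) {..<N} \<and> (\<lambda>i. x i \<omega>) ` {..<N} = atoms (\<xi> \<omega>) A)"
proof -
  obtain \<B> :: "'a set set" where \<B>: "countable \<B>" "topological_basis \<B>"
    using ex_countable_basis by blast
  have open_\<B>: "U \<in> sets borel" if "U \<in> \<B>" for U
    using topological_basis_open[OF \<B>(2) that] by simp
  define L where "L = {us \<in> lists \<B>. \<forall>i j. i < j \<longrightarrow> j < length us \<longrightarrow> us ! i \<inter> us ! j = {}}"
  \<comment> \<open>An integer-valued measure charges \<open>A \<inter> U\<close> iff \<open>U\<close> contains one of the atoms in \<open>A\<close>.\<close>
  define hit where "hit us \<omega> \<longleftrightarrow> (\<forall>i<length us. emeasure (\<xi> \<omega>) (A \<inter> us ! i) > 0)" for us \<omega>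
  define E where "E us = {\<omega> \<in> space P. hit us \<omega> \<and> (\<forall>us'\<in>L. hit us' \<omega> \<longrightarrow> length us' \<le> length us)}" for us
  have L: "countable L"
    unfolding L_def using countable_lists[OF \<B>(1)] by (rule countable_subset[rotated]) auto
  have L_nth: "us ! i \<in> sets borel" if "us \<in> L" "i < length us" for us i
    using that open_\<B> by (auto simp: L_def)
  have emeas: "(\<lambda>\<omega>. emeasure (\<xi> \<omega>) (A \<inter> C)) \<in> borel_measurable P" if "C \<in> sets borel" for C
    by (rule emeasure_random_measure_measurable[OF \<xi> bounded_borel_Int[OF A that]])
  have hit_meas: "Measurable.pred P (hit us)" if us: "us \<in> L" for us
  proof -
    have "Measurable.pred P (\<lambda>\<omega>. emeasure (\<xi> \<omega>) (A \<inter> us ! i) > 0)" if "i < length us" for i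
      using emeas[OF L_nth[OF us that]] by measurable
    then have "Measurable.pred P (\<lambda>\<omega>. \<forall>i\<in>{..<length us}. emeasure (\<xi> \<omega>) (A \<inter> us ! i) > 0)"
      by (intro pred_intros_countable_bounded) auto
    then show ?thesis
      unfolding hit_def Ball_def lessThan_iff .
  qed
  have E_meas: "E us \<in> sets P" if "us \<in> L" for us
  proof -
    have "E us = {\<omega> \<in> space P. hit us \<omega>}
        - (\<Union>us'\<in>{us' \<in> L. length us < length us'}. {\<omega> \<in> space P. hit us' \<omega>})"
      by (auto simp: E_def not_le[symmetric])
    also have "\<dots> \<in> sets P"
      using L hit_meas that
      by (intro sets.Diff sets.countable_UN'' countable_subset[OF _ L]) (auto simp: pred_def)
    finally show ?thesis .
  qed
  have hit_iff: "hit us \<omega> \<longleftrightarrow> (\<forall>i<length us. atoms (\<xi> \<omega>) A \<inter> us ! i \<noteq> {})"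
    if "us \<in> L" "\<omega> \<in> space P" for us \<omega>
  proof -
    have "atoms (\<xi> \<omega>) (A \<inter> U) = atoms (\<xi> \<omega>) A \<inter> U" for U by (auto simp: atoms_def)
    then show ?thesis
      using emeasure_pos_iff_atom[OF count[OF that(2)] bounded_borel_Int[OF A L_nth[OF that(1)]]]
      unfolding hit_def by simp
  qed
  have len_le: "length us \<le> card (atoms (\<xi> \<omega>) A)" if us: "us \<in> L" "\<omega> \<in> space P" and h: "hit us \<omega>" for us \<omega>
  proof -
    have "\<forall>i. \<exists>y. i < length us \<longrightarrow> y \<in> atoms (\<xi> \<omega>) A \<inter> us ! i" using h hit_iff[OF us] by blast
    then obtain y where y: "\<And>i. i < length us \<Longrightarrow> y i \<in> atoms (\<xi> \<omega>) A \<inter> us ! i" by metis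
    have dis: "us ! i \<inter> us ! j = {}" if "i < j" "j < length us" for i j
      using us(1) that by (simp add: L_def)
    have "inj_on y {..<length us}"
    proof (rule inj_onI)
      fix i j assume *: "i \<in> {..<length us}" "j \<in> {..<length us}" "y i = y j"
      then have "us ! i \<inter> us ! j \<noteq> {}" using y[of i] y[of j] by auto
      then show "i = j" using dis[of i j] dis[of j i] * by (metis Int_commute lessThan_iff nat_neq_iff)
    qed
    moreover have "y ` {..<length us} \<subseteq> atoms (\<xi> \<omega>) A" using y by auto
    ultimately show ?thesis
      using card_inj_on_le[of y "{..<length us}"] finite_atoms(1)[OF count[OF us(2)] A] by simp
  qed
  have full: "\<exists>us\<in>L. hit us \<omega> \<and> length us = card (atoms (\<xi> \<omega>) A)" if \<omega>: "\<omega> \<in> space P" for \<omega>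
  proof -
    obtain us where us: "length us = card (atoms (\<xi> \<omega>) A)" "set us \<subseteq> \<B>"
      "\<And>u. u \<in> set us \<Longrightarrow> atoms (\<xi> \<omega>) A \<inter> u \<noteq> {}"
      "\<And>i j. i < j \<Longrightarrow> j < length us \<Longrightarrow> us ! i \<inter> us ! j = {}"
      using separated_basis_sets[OF finite_atoms(1)[OF count[OF \<omega>] A] \<B>(2)] by metis
    then have "us \<in> L" by (auto simp: L_def)
    moreover have "hit us \<omega>" using us(3) hit_iff[OF \<open>us \<in> L\<close> \<omega>] by simp
    ultimately show ?thesis using us(1) by blast
  qed
  have E_card: "length us = card (atoms (\<xi> \<omega>) A)" if "us \<in> L" "\<omega> \<in> E us" for us \<omega>
    using that full[of \<omega>] len_le[of us \<omega>] by (force simp: E_def)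
  show ?thesis
  proof (rule that[of "E ` L"])
    show "countable (E ` L)" using L by simp
    show "E ` L \<subseteq> sets P" using E_meas by auto
    show "space P \<subseteq> \<Union>(E ` L)"
    proof
      fix \<omega> assume \<omega>: "\<omega> \<in> space P"
      obtain us where "us \<in> L" "hit us \<omega>" "length us = card (atoms (\<xi> \<omega>) A)" using full[OF \<omega>] by blast
      then have "\<omega> \<in> E us" using len_le[OF _ \<omega>] \<omega> by (simp add: E_def)
      with \<open>us \<in> L\<close> show "\<omega> \<in> \<Union>(E ` L)" by blast
    qed
    fix E' assume "E' \<in> E ` L"
    then obtain us where us: "us \<in> L" and E': "E' = E us" by blast
    define x where "x i \<omega> = (SOME y. y \<in> atoms (\<xi> \<omega>) A \<inter> us ! i)" for i \<omega>
    have space_E: "\<omega> \<in> space P" "hit us \<omega>" if "\<omega> \<in> E us" for \<omega> using that by (auto simp: E_def)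
    have ne: "atoms (\<xi> \<omega>) A \<inter> us ! i \<noteq> {}" if "\<omega> \<in> E us" "i < length us" for i \<omega>
      using that hit_iff[OF us] space_E by blast
    have x: "x i \<omega> \<in> atoms (\<xi> \<omega>) A \<inter> us ! i" if "\<omega> \<in> E us" "i < length us" for i \<omega>
    proof -
      from ne[OF that] obtain y where "y \<in> atoms (\<xi> \<omega>) A \<inter> us ! i" by blast
      then show ?thesis unfolding x_def by (rule someI)
    qed
    have cell: "inj_on (\<lambda>i. x i \<omega>) {..<length us}" "(\<lambda>i. x i \<omega>) ` {..<length us} = atoms (\<xi> \<omega>) A"
      "\<And>i y. i < length us \<Longrightarrow> y \<in> atoms (\<xi> \<omega>) A \<inter> us ! i \<Longrightarrow> y = x i \<omega>" if \<omega>: "\<omega> \<in> E us" for \<omega>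
    proof -
      have fin: "finite (atoms (\<xi> \<omega>) A)" using finite_atoms(1)[OF count[OF space_E(1)[OF \<omega>]] A] .
      have dis: "us ! i \<inter> us ! j = {}" if "i < j" "j < length us" for i j
        using us that by (simp add: L_def)
      note len = E_card[OF us \<omega>]
      have ne': "atoms (\<xi> \<omega>) A \<inter> us ! i \<noteq> {}"
        and x': "x i \<omega> \<in> atoms (\<xi> \<omega>) A \<inter> us ! i" if "i < card (atoms (\<xi> \<omega>) A)" for i
        using that ne[OF \<omega>] x[OF \<omega>] len by simp_all
      show "inj_on (\<lambda>i. x i \<omega>) {..<length us}"
        unfolding len by (rule one_point_per_cell(1)[OF fin len]) (fact ne', fact dis, fact x')
      show "(\<lambda>i. x i \<omega>) ` {..<length us} = atoms (\<xi> \<omega>) A"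
        unfolding len by (rule one_point_per_cell(2)[OF fin len]) (fact ne', fact dis, fact x')
      show "y = x i \<omega>" if "i < length us" "y \<in> atoms (\<xi> \<omega>) A \<inter> us ! i" for i y
        by (rule one_point_per_cell(3)[OF fin len, where x = "\<lambda>i. x i \<omega>"])
          (fact ne', fact dis, fact x', use that len in simp, fact that(2))
    qed
    have "x i \<in> borel_measurable (restrict_space P E')" if i: "i < length us" for i
    proof (rule measurableI)
      fix C :: "'a set" assume C: "C \<in> sets borel"
      have "x i \<omega> \<in> C \<longleftrightarrow> emeasure (\<xi> \<omega>) (A \<inter> (us ! i \<inter> C)) > 0" if \<omega>: "\<omega> \<in> E us" for \<omega>
      proof -
        have "A \<inter> (us ! i \<inter> C) \<in> bounded_borel"
          using L_nth[OF us i] C by (intro bounded_borel_Int[OF A]) auto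
        then have "emeasure (\<xi> \<omega>) (A \<inter> (us ! i \<inter> C)) > 0 \<longleftrightarrow> (\<exists>y\<in>atoms (\<xi> \<omega>) A \<inter> us ! i. y \<in> C)"
          unfolding emeasure_pos_iff_atom[OF count[OF space_E(1)[OF \<omega>]] \<open>A \<inter> (us ! i \<inter> C) \<in> bounded_borel\<close>]
          unfolding atoms_def by blast
        also have "\<dots> \<longleftrightarrow> x i \<omega> \<in> C" using cell(3)[OF \<omega> i] x[OF \<omega> i] by blast
        finally show ?thesis ..
      qed
      then have "x i -` C \<inter> space (restrict_space P E') = {\<omega> \<in> space P. emeasure (\<xi> \<omega>) (A \<inter> (us ! i \<inter> C)) > 0} \<inter> E us"
        using space_E by (auto simp: E' space_restrict_space)
      moreover have "{\<omega> \<in> space P. emeasure (\<xi> \<omega>) (A \<inter> (us ! i \<inter> C)) > 0} \<in> sets P"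
        using emeas[of "us ! i \<inter> C"] L_nth[OF us i] C by measurable
      ultimately show "x i -` C \<inter> space (restrict_space P E') \<in> sets (restrict_space P E')"
        using E_meas[OF us] by (simp add: E' sets_restrict_space_iff)
    qed simp
    with cell(1,2) have "(\<forall>i<length us. x i \<in> borel_measurable (restrict_space P E')) \<and>
       (\<forall>\<omega>\<in>E'. inj_on (\<lambda>i. x i \<omega>) {..<length us} \<and> (\<lambda>i. x i \<omega>) ` {..<length us} = atoms (\<xi> \<omega>) A)"
      unfolding E' by blast
    then show "\<exists>(N::nat) x. (\<forall>i<N. x i \<in> borel_measurable (restrict_space P E')) \<and>
       (\<forall>\<omega>\<in>E'. inj_on (\<lambda>i. x i \<omega>) {..<N} \<and> (\<lambda>i. x i \<omega>) ` {..<N} = atoms (\<xi> \<omega>) A)"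
      by blast
  qed
qed

section \<open>Measurability of the diagram\<close>

text \<open>
  With the strict inequality the admissible centres form an open set, so it is enough to look at a
  countable dense set of centres.
\<close>

lemma cech_radius_less_iff:
  fixes \<sigma> :: "'a::heine_borel set"
  assumes \<sigma>: "finite \<sigma>" "\<sigma> \<noteq> {}" and D: "\<And>U. open U \<Longrightarrow> U \<noteq> {} \<Longrightarrow> \<exists>d\<in>D. d \<in> U"
  shows "cech_radius \<sigma> < y \<longleftrightarrow> (\<exists>z\<in>D. \<forall>x\<in>\<sigma>. dist x z < y)"
proof
  assume less: "cech_radius \<sigma> < y"
  obtain z where "z \<in> (\<Inter>x\<in>\<sigma>. cball x (cech_radius \<sigma>))"
    using Inter_cball_iff_radius_le[OF \<sigma>, of "cech_radius \<sigma>"] by blast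
  then have "z \<in> (\<Inter>x\<in>\<sigma>. ball x y)" using less by auto
  moreover have "open (\<Inter>x\<in>\<sigma>. ball x y)" using \<sigma>(1) by (intro open_INT ballI open_ball)
  ultimately obtain d where "d \<in> D" "d \<in> (\<Inter>x\<in>\<sigma>. ball x y)" using D by blast
  then show "\<exists>z\<in>D. \<forall>x\<in>\<sigma>. dist x z < y" by auto
next
  assume "\<exists>z\<in>D. \<forall>x\<in>\<sigma>. dist x z < y"
  then obtain z where z: "\<And>x. x \<in> \<sigma> \<Longrightarrow> dist x z < y" by blast
  let ?m = "Max ((\<lambda>x. dist x z) ` \<sigma>)"
  have "z \<in> (\<Inter>x\<in>\<sigma>. cball x ?m)" using \<sigma> by auto
  then have "cech_radius \<sigma> \<le> ?m" using Inter_cball_iff_radius_le[OF \<sigma>] by blast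
  also have "?m < y" using \<sigma> z by simp
  finally show "cech_radius \<sigma> < y" .
qed

lemma cech_radius_measurable:
  fixes x :: "'i \<Rightarrow> 'w \<Rightarrow> 'a::euclidean_space"
  assumes \<rho>: "finite \<rho>" "\<rho> \<noteq> {}" and x: "\<And>i. i \<in> \<rho> \<Longrightarrow> x i \<in> borel_measurable M"
  shows "(\<lambda>\<omega>. cech_radius ((\<lambda>i. x i \<omega>) ` \<rho>)) \<in> borel_measurable M"
proof (rule borel_measurableI_less)
  fix y :: real
  obtain D :: "'a set" where D: "countable D" "\<And>U. open U \<Longrightarrow> U \<noteq> {} \<Longrightarrow> \<exists>d\<in>D. d \<in> U"
    by (rule countable_dense_setE) blast
  have "{\<omega> \<in> space M. cech_radius ((\<lambda>i. x i \<omega>) ` \<rho>) < y}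
      = (\<Union>z\<in>D. {\<omega> \<in> space M. \<forall>i\<in>\<rho>. dist (x i \<omega>) z < y})"
    using cech_radius_less_iff[OF _ _ D(2), of "(\<lambda>i. x i _) ` \<rho>" y] \<rho> by auto
  also have "\<dots> \<in> sets M"
  proof (intro sets.countable_UN'' D(1))
    fix z
    have "Measurable.pred M (\<lambda>\<omega>. dist (x i \<omega>) z < y)" if "i \<in> \<rho>" for i
      using x[OF that] by measurable
    then have "Measurable.pred M (\<lambda>\<omega>. \<forall>i\<in>\<rho>. dist (x i \<omega>) z < y)"
      by (rule pred_intros_finite(3)[OF \<rho>(1)])
    then show "{\<omega> \<in> space M. \<forall>i\<in>\<rho>. dist (x i \<omega>) z < y} \<in> sets M" by (simp add: pred_def)
  qed
  finally show "{\<omega> \<in> space M. cech_radius ((\<lambda>i. x i \<omega>) ` \<rho>) < y} \<in> sets M" .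
qed

text \<open>
  The bijection between two enumerated point sets extends to a bijection of the whole space, which maps the
  sublevel complexes of one filtration to those of the other as soon as the entry radii are ordered alike.
\<close>

lemma pd_mult_order_type:
  fixes x y :: "'i \<Rightarrow> 'a::heine_borel"
  assumes I: "finite I" and x: "inj_on x I" and y: "inj_on y I"
    and ord: "\<forall>\<rho>\<in>simplices l I. \<forall>\<rho>'\<in>simplices l I.
      cech_radius (x ` \<rho>) \<le> cech_radius (x ` \<rho>') \<longleftrightarrow> cech_radius (y ` \<rho>) \<le> cech_radius (y ` \<rho>')"
    and \<sigma>: "\<sigma> \<in> simplices l I" and \<tau>: "\<tau> \<in> simplices l I"
  shows "pd_mult F l (y ` I) (cech_radius (y ` \<sigma>), cech_radius (y ` \<tau>))
       = pd_mult F l (x ` I) (cech_radius (x ` \<sigma>), cech_radius (x ` \<tau>))"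
proof -
  let ?f = "y \<circ> inv_into I x"
  have "bij_betw ?f (x ` I) (y ` I)"
    using bij_betw_trans[OF bij_betw_inv_into[OF inj_on_imp_bij_betw[OF x]] inj_on_imp_bij_betw[OF y]] .
  then obtain g where g: "bij g" "\<And>v. v \<in> x ` I \<Longrightarrow> g v = ?f v"
    using bij_betw_finite_extend[OF finite_imageI[OF I]] by metis
  have gx: "g ` x ` \<rho> = y ` \<rho>" if "\<rho> \<subseteq> I" for \<rho>
    unfolding image_image using that g(2) x by (intro image_cong refl) (auto simp: inv_into_f_f subset_iff)
  have lt: "cech_radius (x ` \<rho>) < cech_radius (x ` \<rho>') \<longleftrightarrow> cech_radius (y ` \<rho>) < cech_radius (y ` \<rho>')"
    if "\<rho> \<in> simplices l I" "\<rho>' \<in> simplices l I" for \<rho> \<rho>'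
    using ord that by (meson not_le)
  have rel: "cech_radius (g ` \<rho>) \<le> cech_radius (y ` \<rho>') \<longleftrightarrow> cech_radius \<rho> \<le> cech_radius (x ` \<rho>')"
    "cech_radius (g ` \<rho>) < cech_radius (y ` \<rho>') \<longleftrightarrow> cech_radius \<rho> < cech_radius (x ` \<rho>')"
    if \<rho>: "\<rho> \<in> simplices l (x ` I)" and \<rho>': "\<rho>' \<in> simplices l I" for \<rho> \<rho>'
  proof -
    obtain \<pi> where \<pi>: "\<pi> \<in> simplices l I" "\<rho> = x ` \<pi>" using \<rho> unfolding simplices_image[OF x] by blast
    have "g ` \<rho> = y ` \<pi>" using gx[of \<pi>] \<pi> by (simp add: simplices_def)
    then show "cech_radius (g ` \<rho>) \<le> cech_radius (y ` \<rho>') \<longleftrightarrow> cech_radius \<rho> \<le> cech_radius (x ` \<rho>')"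
      "cech_radius (g ` \<rho>) < cech_radius (y ` \<rho>') \<longleftrightarrow> cech_radius \<rho> < cech_radius (x ` \<rho>')"
      using ord \<pi>(1) \<rho>' lt[OF \<pi>(1) \<rho>'] by (simp_all add: \<pi>(2))
  qed
  have "pd_mult F l (g ` x ` I) (cech_radius (y ` \<sigma>), cech_radius (y ` \<tau>))
       = pd_mult F l (x ` I) (cech_radius (x ` \<sigma>), cech_radius (x ` \<tau>))"
    by (rule pd_mult_relabel[OF g(1) finite_imageI[OF I]])
       (erule rel(1)[OF _ \<sigma>], erule rel(2)[OF _ \<sigma>], erule rel(1)[OF _ \<tau>], erule rel(2)[OF _ \<tau>])
  then show ?thesis by (simp add: gx)
qed

lemma Delta_borel: "Delta \<in> sets borel"
proof -
  have "Delta = {p. fst p < snd p}" by (auto simp: Delta_def)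
  moreover have "open {p :: real \<times> real. fst p < snd p}"
    by (intro open_Collect_less continuous_intros)
  ultimately show ?thesis by simp
qed

text \<open>
  Several simplices may enter at the same radius; the set \<open>S\<close> selects one simplex for each radius of the
  reference configuration \<open>x\<close>, and by the common order type it does the same for \<open>y\<close>. All multiplicities
  are those of the reference configuration.
\<close>

lemma sum_Dgm_order_type:
  fixes x y :: "'i \<Rightarrow> 'a::heine_borel" and f :: "real \<times> real \<Rightarrow> 'c::comm_semiring_1"
  assumes I: "finite I" and x: "inj_on x I" and y: "inj_on y I"
    and ord: "\<forall>\<rho>\<in>simplices l I. \<forall>\<rho>'\<in>simplices l I.
      cech_radius (x ` \<rho>) \<le> cech_radius (x ` \<rho>') \<longleftrightarrow> cech_radius (y ` \<rho>) \<le> cech_radius (y ` \<rho>')"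
    and S: "S \<subseteq> simplices l I" "inj_on (\<lambda>\<rho>. cech_radius (x ` \<rho>)) S"
      "(\<lambda>\<rho>. cech_radius (x ` \<rho>)) ` simplices l I = (\<lambda>\<rho>. cech_radius (x ` \<rho>)) ` S"
  shows "(\<Sum>p\<in>#Dgm F l (y ` I). f p) = (\<Sum>(\<sigma>, \<tau>)\<in>S \<times> S.
      if (cech_radius (y ` \<sigma>), cech_radius (y ` \<tau>)) \<in> Delta
      then of_nat (pd_mult F l (x ` I) (cech_radius (x ` \<sigma>), cech_radius (x ` \<tau>)))
        * f (cech_radius (y ` \<sigma>), cech_radius (y ` \<tau>)) else 0)"
proof -
  let ?r = "\<lambda>\<rho>. cech_radius (y ` \<rho>)"
  have eq: "cech_radius (x ` \<rho>) = cech_radius (x ` \<rho>') \<longleftrightarrow> ?r \<rho> = ?r \<rho>'"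
    if "\<rho> \<in> simplices l I" "\<rho>' \<in> simplices l I" for \<rho> \<rho>'
    unfolding order_eq_iff[where 'a = real] using ord that by blast
  have inj: "inj_on ?r S" using S(1,2) eq by (auto simp: inj_on_def subset_iff)
  have "?r ` simplices l I = ?r ` S"
  proof
    show "?r ` simplices l I \<subseteq> ?r ` S"
    proof
      fix v assume "v \<in> ?r ` simplices l I"
      then obtain \<rho> where \<rho>: "\<rho> \<in> simplices l I" "v = ?r \<rho>" by blast
      then obtain \<rho>' where "\<rho>' \<in> S" "cech_radius (x ` \<rho>) = cech_radius (x ` \<rho>')" using S(3) by blast
      then show "v \<in> ?r ` S" using eq[of \<rho> \<rho>'] \<rho> S(1) by blast
    qed
  qed (use S(1) in blast)
  then have crit: "crit_pairs l (y ` I) = (\<lambda>(\<sigma>, \<tau>). (?r \<sigma>, ?r \<tau>)) ` (S \<times> S)"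
    unfolding crit_pairs_def simplices_image[OF y] image_image by auto
  have inj2: "inj_on (\<lambda>(\<sigma>, \<tau>). (?r \<sigma>, ?r \<tau>)) (S \<times> S)" using inj by (auto simp: inj_on_def)
  have "(\<Sum>p\<in>#Dgm F l (y ` I). f p) = (\<Sum>(\<sigma>, \<tau>)\<in>S \<times> S.
      if (?r \<sigma>, ?r \<tau>) \<in> Delta then of_nat (pd_mult F l (y ` I) (?r \<sigma>, ?r \<tau>)) * f (?r \<sigma>, ?r \<tau>) else 0)"
    unfolding sum_mset_Dgm[OF finite_imageI[OF I]] crit sum.reindex[OF inj2]
    by (intro sum.cong refl) auto
  also have "\<dots> = (\<Sum>(\<sigma>, \<tau>)\<in>S \<times> S. if (?r \<sigma>, ?r \<tau>) \<in> Delta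
      then of_nat (pd_mult F l (x ` I) (cech_radius (x ` \<sigma>), cech_radius (x ` \<tau>))) * f (?r \<sigma>, ?r \<tau>) else 0)"
  proof (rule sum.cong[OF refl])
    fix q assume "q \<in> S \<times> S"
    then obtain \<sigma> \<tau> where q: "q = (\<sigma>, \<tau>)" "\<sigma> \<in> simplices l I" "\<tau> \<in> simplices l I" using S(1) by blast
    show "(case q of (\<sigma>, \<tau>) \<Rightarrow> if (?r \<sigma>, ?r \<tau>) \<in> Delta
        then of_nat (pd_mult F l (y ` I) (?r \<sigma>, ?r \<tau>)) * f (?r \<sigma>, ?r \<tau>) else 0)
      = (case q of (\<sigma>, \<tau>) \<Rightarrow> if (?r \<sigma>, ?r \<tau>) \<in> Delta
        then of_nat (pd_mult F l (x ` I) (cech_radius (x ` \<sigma>), cech_radius (x ` \<tau>))) * f (?r \<sigma>, ?r \<tau>) else 0)"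
      unfolding q(1) using pd_mult_order_type[where F = F, OF I x y ord q(2,3)] by simp
  qed
  finally show ?thesis .
qed

lemma sum_Dgm_measurable:
  fixes x :: "'i \<Rightarrow> 'w \<Rightarrow> 'a::euclidean_space"
  assumes I: "finite I" and x: "\<And>i. i \<in> I \<Longrightarrow> x i \<in> borel_measurable M"
    and inj: "\<And>\<omega>. \<omega> \<in> space M \<Longrightarrow> inj_on (\<lambda>i. x i \<omega>) I" and B: "B \<in> sets borel"
  shows "(\<lambda>\<omega>. \<Sum>p\<in>#Dgm F l ((\<lambda>i. x i \<omega>) ` I). indicator B p :: ennreal) \<in> borel_measurable M"
proof -
  define J where "J = simplices l I"
  define r where "r \<rho> \<omega> = cech_radius ((\<lambda>i. x i \<omega>) ` \<rho>)" for \<rho> \<omega>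
  have J: "finite J" unfolding J_def by (rule finite_simplices[OF I])
  have r: "r \<rho> \<in> borel_measurable M" if "\<rho> \<in> J" for \<rho>
    unfolding r_def using that finite_subset[OF _ I] x
    by (intro cech_radius_measurable) (auto simp: J_def simplices_def)
  \<comment> \<open>On a cell the order of the entry radii is constant; any of its points serves as reference configuration.\<close>
  define cell where "cell R = {\<omega> \<in> space M. \<forall>\<rho>\<in>J. \<forall>\<rho>'\<in>J. (r \<rho> \<omega> \<le> r \<rho>' \<omega>) = ((\<rho>, \<rho>') \<in> R)}" for R
  show ?thesis
  proof (rule measurable_piecewise_restrict[where C = "cell ` Pow (J \<times> J)"])
    show "countable (cell ` Pow (J \<times> J))" using J by (intro countable_finite) simp
    show "space M \<subseteq> \<Union> (cell ` Pow (J \<times> J))"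
    proof
      fix \<omega> assume "\<omega> \<in> space M"
      then have "\<omega> \<in> cell {(\<rho>, \<rho>') \<in> J \<times> J. r \<rho> \<omega> \<le> r \<rho>' \<omega>}" by (simp add: cell_def)
      then show "\<omega> \<in> \<Union> (cell ` Pow (J \<times> J))" by (rule UnionI[rotated]) (intro imageI, auto)
    qed
    fix C assume "C \<in> cell ` Pow (J \<times> J)"
    then obtain R where C: "C = cell R" by blast
    have "Measurable.pred M (\<lambda>\<omega>. (r \<rho> \<omega> \<le> r \<rho>' \<omega>) = ((\<rho>, \<rho>') \<in> R))" if "\<rho> \<in> J" "\<rho>' \<in> J" for \<rho> \<rho>'
      using r[OF that(1)] r[OF that(2)] by measurable
    then have "Measurable.pred M (\<lambda>\<omega>. \<forall>\<rho>\<in>J. \<forall>\<rho>'\<in>J. (r \<rho> \<omega> \<le> r \<rho>' \<omega>) = ((\<rho>, \<rho>') \<in> R))"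
      by (intro pred_intros_finite(3) J)
    then have "cell R \<in> sets M" unfolding cell_def by (simp add: pred_def)
    then show "C \<inter> space M \<in> sets M" unfolding C by simp
    let ?M = "restrict_space M C"
    have space: "space ?M = cell R" unfolding C space_restrict_space by (auto simp: cell_def)
    show "(\<lambda>\<omega>. \<Sum>p\<in>#Dgm F l ((\<lambda>i. x i \<omega>) ` I). indicator B p :: ennreal) \<in> borel_measurable ?M"
    proof (cases "cell R = {}")
      case True
      then show ?thesis using space by (intro measurableI) auto
    next
      case False
      then obtain \<omega>0 where \<omega>0: "\<omega>0 \<in> cell R" by blast
      obtain S where S: "S \<subseteq> J" "inj_on (\<lambda>\<rho>. r \<rho> \<omega>0) S" "(\<lambda>\<rho>. r \<rho> \<omega>0) ` J = (\<lambda>\<rho>. r \<rho> \<omega>0) ` S"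
        using subset_image_inj[of "(\<lambda>\<rho>. r \<rho> \<omega>0) ` J" "\<lambda>\<rho>. r \<rho> \<omega>0" J] by auto
      define c :: "'i set \<times> 'i set \<Rightarrow> ennreal"
        where "c q = of_nat (pd_mult F l ((\<lambda>i. x i \<omega>0) ` I) (r (fst q) \<omega>0, r (snd q) \<omega>0))" for q
      have eq: "(\<Sum>p\<in>#Dgm F l ((\<lambda>i. x i \<omega>) ` I). indicator B p) =
          (\<Sum>q\<in>S \<times> S. c q * indicator (B \<inter> Delta) (r (fst q) \<omega>, r (snd q) \<omega>))" if \<omega>: "\<omega> \<in> space ?M" for \<omega>
      proof -
        have \<omega>': "\<omega> \<in> cell R" using \<omega> space by simp
        have ord: "\<forall>\<rho>\<in>J. \<forall>\<rho>'\<in>J. r \<rho> \<omega>0 \<le> r \<rho>' \<omega>0 \<longleftrightarrow> r \<rho> \<omega> \<le> r \<rho>' \<omega>"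
          using \<omega>' \<omega>0 by (simp add: cell_def)
        have inj0: "inj_on (\<lambda>i. x i \<omega>0) I" "inj_on (\<lambda>i. x i \<omega>) I"
          using inj \<omega>0 \<omega>' by (auto simp: cell_def)
        show ?thesis
          unfolding sum_Dgm_order_type[OF I inj0 ord[unfolded r_def J_def] S[unfolded r_def J_def]]
          by (intro sum.cong refl) (auto simp: c_def r_def indicator_def)
      qed
      have "(\<lambda>\<omega>. c q * indicator (B \<inter> Delta) (r (fst q) \<omega>, r (snd q) \<omega>)) \<in> borel_measurable ?M"
        if q: "q \<in> S \<times> S" for q
      proof -
        have [measurable]: "r (fst q) \<in> borel_measurable ?M" "r (snd q) \<in> borel_measurable ?M"
          using q S(1) by (auto intro!: measurable_restrict_space1 r)
        have [measurable]: "B \<inter> Delta \<in> sets (borel \<Otimes>\<^sub>M borel)"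
          using sets.Int[OF B Delta_borel] unfolding borel_prod .
        show ?thesis by measurable
      qed
      then have "(\<lambda>\<omega>. \<Sum>q\<in>S \<times> S. c q * indicator (B \<inter> Delta) (r (fst q) \<omega>, r (snd q) \<omega>)) \<in> borel_measurable ?M"
        by (rule borel_measurable_sum)
      then show ?thesis using eq by (simp cong: measurable_cong)
    qed
  qed
qed

section \<open>The expectation measure\<close>

lemma space_borel_Delta: "space borel_Delta = Delta"
  by (simp add: borel_Delta_def space_restrict_space)

lemma sets_borel_Delta: "B \<in> sets borel_Delta \<longleftrightarrow> B \<in> sets borel \<and> B \<subseteq> Delta"
  unfolding borel_Delta_def using Delta_borel by (subst sets_restrict_space_iff) auto

lemma sigma_algebra_borel_Delta: "sigma_algebra Delta (sets borel_Delta)"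
  using sets.sigma_algebra_axioms[of borel_Delta] by (simp add: space_borel_Delta)

lemma sets_measure_of_borel_Delta: "sets (measure_of Delta (sets borel_Delta) \<mu>) = sets borel_Delta"
  using sigma_algebra.sets_measure_of_eq[OF sigma_algebra_borel_Delta] .

lemma emeasure_dirac_sum:
  assumes "B \<in> sets borel_Delta"
  shows "emeasure (dirac_sum D) B = (\<Sum>x\<in>#D. indicator B x)"
proof -
  let ?\<mu> = "\<lambda>D B. \<Sum>x\<in>#D. indicator B x :: ennreal"
  have "countably_additive (sets borel_Delta) (?\<mu> D)"
  proof (rule countably_additiveI)
    fix C :: "nat \<Rightarrow> (real \<times> real) set" assume dis: "disjoint_family C"
    show "(\<Sum>i. ?\<mu> D (C i)) = ?\<mu> D (\<Union>i. C i)"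
    proof (induction D)
      case (add x D)
      have "(\<Sum>i. ?\<mu> (add_mset x D) (C i)) = (\<Sum>i. indicator (C i) x + ?\<mu> D (C i))" by simp
      also have "\<dots> = (\<Sum>i. indicator (C i) x) + (\<Sum>i. ?\<mu> D (C i))"
        by (intro suminf_add[symmetric] summableI)
      also have "\<dots> = ?\<mu> (add_mset x D) (\<Union>i. C i)"
        using add.IH suminf_indicator[OF dis, of x] by simp
      finally show ?case .
    qed simp
  qed
  moreover have "positive (sets borel_Delta) (?\<mu> D)" by (simp add: positive_def)
  ultimately show ?thesis
    unfolding dirac_sum_def using assms
    by (intro emeasure_measure_of_sigma sigma_algebra_borel_Delta)
qed

lemma sum_mset_sum:
  fixes D :: "nat \<Rightarrow> 'b multiset" and f :: "'b \<Rightarrow> 'c::comm_monoid_add"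
  shows "(\<Sum>x\<in>#(\<Sum>i<n. D i). f x) = (\<Sum>i<n. \<Sum>x\<in>#D i. f x)"
  by (induction n) auto

lemma emeasure_pd_measure:
  fixes \<mu> :: "(real ^ 'n) measure"
  assumes "B \<in> sets borel_Delta"
  shows "emeasure (pd_measure F \<mu> A) B = (\<Sum>l<CARD('n). \<Sum>p\<in>#Dgm F l (atoms \<mu> A). indicator B p)"
  unfolding pd_measure_def emeasure_dirac_sum[OF assms] sum_mset_sum ..

text \<open>
  Countable additivity of the expectation is monotone convergence.
\<close>

lemma first_moment_measure_exists:
  assumes sets: "\<And>\<omega>. \<omega> \<in> space P \<Longrightarrow> sets (\<rho> \<omega>) = sets borel_Delta"
    and meas: "\<And>B. B \<in> sets borel_Delta \<Longrightarrow> (\<lambda>\<omega>. emeasure (\<rho> \<omega>) B) \<in> borel_measurable P"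
    and fin: "\<And>B. B \<in> sets borel_Delta \<Longrightarrow> (\<integral>\<^sup>+ \<omega>. emeasure (\<rho> \<omega>) B \<partial>P) < \<infinity>"
  shows "\<exists>m. first_moment_measure P \<rho> m"
proof -
  let ?\<mu> = "\<lambda>B. \<integral>\<^sup>+ \<omega>. emeasure (\<rho> \<omega>) B \<partial>P"
  define m where "m = measure_of Delta (sets borel_Delta) ?\<mu>"
  have "countably_additive (sets borel_Delta) ?\<mu>"
  proof (rule countably_additiveI)
    fix C :: "nat \<Rightarrow> (real \<times> real) set"
    assume C: "range C \<subseteq> sets borel_Delta" and dis: "disjoint_family C"
    have "(\<Sum>i. ?\<mu> (C i)) = (\<integral>\<^sup>+ \<omega>. (\<Sum>i. emeasure (\<rho> \<omega>) (C i)) \<partial>P)"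
      using C by (intro nn_integral_suminf[symmetric] meas) auto
    also have "\<dots> = ?\<mu> (\<Union>i. C i)"
      using C dis by (intro nn_integral_cong suminf_emeasure) (auto simp: sets)
    finally show "(\<Sum>i. ?\<mu> (C i)) = ?\<mu> (\<Union>i. C i)" .
  qed
  moreover have "positive (sets borel_Delta) ?\<mu>" by (simp add: positive_def)
  ultimately have em: "emeasure m B = ?\<mu> B" if "B \<in> sets borel_Delta" for B
    unfolding m_def using that by (intro emeasure_measure_of_sigma sigma_algebra_borel_Delta)
  have "sets m = sets borel_Delta" unfolding m_def by (rule sets_measure_of_borel_Delta)
  then have "radon_on_Delta m" unfolding radon_on_Delta_def using em fin by simp
  then have "first_moment_measure P \<rho> m"
    unfolding first_moment_measure_def using em meas by simp
  then show ?thesis ..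
qed

lemma sum_indicator_Dgm_le:
  fixes X :: "'a::heine_borel set"
  assumes X: "finite X" and N: "of_nat (card X) \<le> (a :: ennreal)"
  shows "(\<Sum>p\<in>#Dgm F l X. indicator B p) \<le> of_nat (4 * ((THE m::nat. False) + 2)) * a ^ (3 * l + 5)"
proof -
  have "(\<Sum>p\<in>#D. indicator B p :: ennreal) \<le> of_nat (size D)" for D :: "(real \<times> real) multiset"
  proof (induction D)
    case (add x D)
    have "indicator B x + (\<Sum>p\<in>#D. indicator B p :: ennreal) \<le> 1 + of_nat (size D)"
      by (intro add_mono add.IH) (simp add: indicator_def)
    then show ?case by simp
  qed simp
  then have "(\<Sum>p\<in>#Dgm F l X. indicator B p :: ennreal) \<le> of_nat (size (Dgm F l X))" .
  also have "\<dots> \<le> of_nat (4 * ((THE m::nat. False) + 2) * card X ^ (3 * l + 5))"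
    unfolding of_nat_le_iff by (rule size_Dgm_le[OF X])
  also have "\<dots> = of_nat (4 * ((THE m::nat. False) + 2)) * of_nat (card X) ^ (3 * l + 5)"
    by (simp only: of_nat_mult of_nat_power)
  also have "\<dots> \<le> of_nat (4 * ((THE m::nat. False) + 2)) * a ^ (3 * l + 5)"
    using N by (intro mult_left_mono power_mono) auto
  finally show ?thesis .
qed

text \<open>
  On each event of the cover the atoms in \<open>A\<close> are given by measurable maps, which yields measurability; the bound
  on the size of the diagrams is a polynomial in the mass of \<open>A\<close>, whose moments are finite.
\<close>

theorem lemma3p1:
  fixes P :: "'w measure" and \<xi> :: "'w \<Rightarrow> (real ^ 'n) measure"
  assumes "prob_space P"
    and "point_process P \<xi>"
    and "\<forall>A\<in>bounded_borel. emeasure lborel A > 0 \<longrightarrow> (\<integral>\<^sup>+ \<omega>. emeasure (\<xi> \<omega>) A \<partial>P) > 0"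
    and "simple_process P \<xi>"
    and "stationary P \<xi>"
    and "ergodic P \<xi>"
    and "all_finite_moments P \<xi>"
  shows "\<exists>\<pp>. pd_expectation_measure TYPE('k::field) P \<xi> \<pp>"
proof -
  let ?F = "TYPE('k)" and ?c = "of_nat (4 * ((THE m::nat. False) + 2)) :: ennreal"
  have \<xi>: "\<xi> \<in> measurable P bf_borel"
    using \<open>point_process P \<xi>\<close> by (simp add: point_process_def)
  have count: "integer_valued_measure (\<xi> \<omega>)" if "\<omega> \<in> space P" for \<omega>
    using \<open>point_process P \<xi>\<close> random_measure_boundedly_finite[OF \<xi> that] that
    by (simp add: point_process_def integer_valued_measure_def)
  have "\<exists>m. first_moment_measure P (\<lambda>\<omega>. pd_measure ?F (\<xi> \<omega>) A) m" if A: "A \<in> bounded_borel" for A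
  proof (rule first_moment_measure_exists)
    show "sets (pd_measure ?F (\<xi> \<omega>) A) = sets borel_Delta" for \<omega>
      unfolding pd_measure_def dirac_sum_def by (rule sets_measure_of_borel_Delta)
    fix B assume B: "B \<in> sets borel_Delta"
    have "(\<lambda>\<omega>. \<Sum>p\<in>#Dgm ?F l (atoms (\<xi> \<omega>) A). indicator B p :: ennreal) \<in> borel_measurable P" for l
    proof -
      obtain \<E> where \<E>: "countable \<E>" "\<E> \<subseteq> sets P" "space P \<subseteq> \<Union>\<E>"
        and enum: "\<And>E. E \<in> \<E> \<Longrightarrow> \<exists>(N::nat) x. (\<forall>i<N. x i \<in> borel_measurable (restrict_space P E)) \<and>
          (\<forall>\<omega>\<in>E. inj_on (\<lambda>i. x i \<omega>) {..<N} \<and> (\<lambda>i. x i \<omega>) ` {..<N} = atoms (\<xi> \<omega>) A)"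
        using measurable_enumeration_of_atoms[OF \<xi> count A] by blast
      show ?thesis
      proof (rule measurable_piecewise_restrict[OF \<E>(1) _ \<E>(3)])
        fix E assume E: "E \<in> \<E>"
        show "E \<inter> space P \<in> sets P" using E \<E>(2) by auto
        obtain N :: nat and x where x: "\<And>i. i < N \<Longrightarrow> x i \<in> borel_measurable (restrict_space P E)"
          and enum: "\<And>\<omega>. \<omega> \<in> E \<Longrightarrow> inj_on (\<lambda>i. x i \<omega>) {..<N}"
            "\<And>\<omega>. \<omega> \<in> E \<Longrightarrow> (\<lambda>i. x i \<omega>) ` {..<N} = atoms (\<xi> \<omega>) A"
          using enum[OF E] by metis
        have E_space: "\<omega> \<in> E" if "\<omega> \<in> space (restrict_space P E)" for \<omega>
          using that by (simp add: space_restrict_space)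
        have "(\<lambda>\<omega>. \<Sum>p\<in>#Dgm ?F l ((\<lambda>i. x i \<omega>) ` {..<N}). indicator B p :: ennreal)
            \<in> borel_measurable (restrict_space P E)"
          using x enum(1) E_space B by (intro sum_Dgm_measurable) (auto simp: sets_borel_Delta)
        then show "(\<lambda>\<omega>. \<Sum>p\<in>#Dgm ?F l (atoms (\<xi> \<omega>) A). indicator B p :: ennreal)
            \<in> borel_measurable (restrict_space P E)"
          by (rule measurable_cong[THEN iffD1, rotated]) (simp add: enum(2) E_space)
      qed
    qed
    then show "(\<lambda>\<omega>. emeasure (pd_measure ?F (\<xi> \<omega>) A) B) \<in> borel_measurable P"
      unfolding emeasure_pd_measure[OF B] by (intro borel_measurable_sum)
    have pow: "(\<lambda>\<omega>. emeasure (\<xi> \<omega>) A ^ k) \<in> borel_measurable P" for k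
      by (induction k) (auto intro: emeasure_random_measure_measurable[OF \<xi> A] borel_measurable_times_ennreal)
    have "(\<integral>\<^sup>+ \<omega>. emeasure (pd_measure ?F (\<xi> \<omega>) A) B \<partial>P)
        \<le> (\<integral>\<^sup>+ \<omega>. (\<Sum>l<CARD('n). ?c * emeasure (\<xi> \<omega>) A ^ (3 * l + 5)) \<partial>P)"
      unfolding emeasure_pd_measure[OF B]
      by (intro nn_integral_mono sum_mono sum_indicator_Dgm_le finite_atoms[OF count A])
    also have "\<dots> = (\<Sum>l<CARD('n). ?c * (\<integral>\<^sup>+ \<omega>. emeasure (\<xi> \<omega>) A ^ (3 * l + 5) \<partial>P))"
      by (simp add: nn_integral_sum nn_integral_cmult pow borel_measurable_times_ennreal)
    also have "\<dots> < \<infinity>"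
    proof -
      have "(\<integral>\<^sup>+ \<omega>. emeasure (\<xi> \<omega>) A ^ (3 * l + 5) \<partial>P) < \<infinity>" for l
        using \<open>all_finite_moments P \<xi>\<close> A unfolding all_finite_moments_def by simp
      then show ?thesis
        by (simp add: ennreal_mult_less_top of_nat_less_top del: of_nat_mult)
    qed
    finally show "(\<integral>\<^sup>+ \<omega>. emeasure (pd_measure ?F (\<xi> \<omega>) A) B \<partial>P) < \<infinity>" .
  qed
  then have "\<forall>A\<in>bounded_borel. \<exists>m. first_moment_measure P (\<lambda>\<omega>. pd_measure ?F (\<xi> \<omega>) A) m" by blast
  then show ?thesis unfolding pd_expectation_measure_def by (rule bchoice)
qed

end
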